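(* Let $d\in\mathbb N$. There is a constant $c>0$, depending on $d$ but independent of the mesh size $h=1/m$ and of the spline degree $p$, such that for all $p,m\in\mathbb N$ (positive integers) and all $u\in S^d$, $$c^{-1}|u|_1^2\;\le\;\sum_{\alpha\in\{0,1\}^d}|Q_\alpha u|_1^2\;\le\;c\,|u|_1^2,$$ and likewise $$c^{-1}\|u\|_1^2\;\le\;\sum_{\alpha\in\{0,1\}^d}\|Q_\alpha u\|_1^2\;\le\;c\,\|u\|_1^2 .$$
   Context: For positive integers $p$ (spline degree) and $m$, put $h=1/m$ and let $$S=\{u\in C^{p-1}(0,1): u|_{((j-1)h,jh)}\in\mathcal P^p\ \ \forall j=1,\dots,m\},$$ where $C^{p-1}(0,1)$ is the space of $p-1$ times continuously differentiable functions and $\mathcal P^p$ is the space of polynomials of degree at most $p$. Let $$S_0=\{u\in S: u^{(2l+1)}(0)=u^{(2l+1)}(1)=0\ \ \forall l\in\mathbb N_0 \text{ with } 2l+1<p\}$$ (boundary values of derivatives are one-sided limits), and let $S_1$ be the $L_2(0,1)$-orthogonal complement of $S_0$ in $S$. Let $Q_0:S\to S_0$ be the $L_2(0,1)$-orthogonal projector and $Q_1=I-Q_0:S\to S_1$. Let $\Omega=(0,1)^d$ and let $S^d=S\otimes\dots\otimes S$ ($d$ factors) be the space of tensor product splines on $\Omega$. For $\alpha=(\alpha_1,\dots,\alpha_d)\in\{0,1\}^d$ let $S_\alpha=S_{\alpha_1}\otimes\dots\otimes S_{\alpha_d}$ and $Q_\alpha=Q_{\alpha_1}\otimes\dots\otimes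 Q_{\alpha_d}:S^d\to S_\alpha$; then $S^d=\bigoplus_\alpha S_\alpha$. $\|\cdot\|_0$ is the $L_2(\Omega)$-norm, $|u|_1=\|\nabla u\|_0$ is the $H^1(\Omega)$-seminorm, and $\|u\|_1^2=\|u\|_0^2+|u|_1^2$. *)

theory Defs
  imports "HOL-Analysis.Analysis"
begin

definition C_on :: "nat \<Rightarrow> real set \<Rightarrow> (real \<Rightarrow> real) \<Rightarrow> bool" where
  "C_on k A u \<longleftrightarrow>
     (\<forall>j<k. (deriv ^^ j) u differentiable_on A) \<and> continuous_on A ((deriv ^^ k) u)"

(* A function on (0,1) is represented by its extension by zero to the real line, so that equality
   of functions on (0,1) is equality in HOL. Only p >= 1 and m >= 1 are meaningful. *)
definition splines :: "nat \<Rightarrow> nat \<Rightarrow> (real \<Rightarrow> real) set" where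
  "splines p m = {u. (\<forall>t. t \<notin> {0<..<1} \<longrightarrow> u t = 0) \<and>
     C_on (p - 1) {0<..<1} u \<and>
     (\<forall>j\<in>{1..m}. \<exists>q :: real poly. degree q \<le> p \<and>
        (\<forall>t\<in>{(real j - 1) / real m <..< real j / real m}. u t = poly q t))}"

definition splines0 :: "nat \<Rightarrow> nat \<Rightarrow> (real \<Rightarrow> real) set" where
  "splines0 p m = {u \<in> splines p m. \<forall>l. 2 * l + 1 < p \<longrightarrow>
     ((deriv ^^ (2 * l + 1)) u \<longlongrightarrow> 0) (at_right 0) \<and>
     ((deriv ^^ (2 * l + 1)) u \<longlongrightarrow> 0) (at_left 1)}"

definition L2_inner :: "(real \<Rightarrow> real) \<Rightarrow> (real \<Rightarrow> real) \<Rightarrow> real" where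
  "L2_inner u v = (LINT t:{0<..<1}|lebesgue. u t * v t)"

definition L2_proj :: "(real \<Rightarrow> real) set \<Rightarrow> (real \<Rightarrow> real) \<Rightarrow> real \<Rightarrow> real" where
  "L2_proj V u = (THE v. v \<in> V \<and> (\<forall>w\<in>V. L2_inner (\<lambda>t. u t - v t) w = 0))"

(* Q_0 for index 0 and Q_1 = I - Q_0 for index 1; no other index is used. *)
definition spline_proj :: "nat \<Rightarrow> nat \<Rightarrow> nat \<Rightarrow> (real \<Rightarrow> real) \<Rightarrow> real \<Rightarrow> real" where
  "spline_proj p m a u =
     (if a = 0 then L2_proj (splines0 p m) u else (\<lambda>t. u t - L2_proj (splines0 p m) u t))"

(* The sum of the N elementary tensors f k 1 \<otimes> ... \<otimes> f k d with k < N. *)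
definition tensor_sum :: "nat \<Rightarrow> (nat \<Rightarrow> 'n \<Rightarrow> real \<Rightarrow> real) \<Rightarrow> real ^ 'n::finite \<Rightarrow> real" where
  "tensor_sum N f x = (\<Sum>k<N. \<Prod>i\<in>UNIV. f k i (x $ i))"

(* The d-fold algebraic tensor power of V, with d = CARD('n), as a space of functions on R^d.
   For a subspace V the scalar coefficients are absorbed into the factors. *)
definition tensor_space :: "(real \<Rightarrow> real) set \<Rightarrow> (real ^ 'n::finite \<Rightarrow> real) set" where
  "tensor_space V = {tensor_sum N f | N f. \<forall>k<N. \<forall>i. f k i \<in> V}"

(* The tensor product of the operators A i, acting on tensor_space V: expand u into elementary
   tensors and apply A i to the i-th factors. For linear A i the outcome does not depend on the
   expansion, see tensor_op_tensor_sum. *)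
definition tensor_op :: "(real \<Rightarrow> real) set \<Rightarrow> ('n \<Rightarrow> (real \<Rightarrow> real) \<Rightarrow> real \<Rightarrow> real) \<Rightarrow>
    (real ^ 'n::finite \<Rightarrow> real) \<Rightarrow> real ^ 'n \<Rightarrow> real" where
  "tensor_op V A u = (THE v. \<exists>N f. (\<forall>k<N. \<forall>i. f k i \<in> V) \<and>
     u = tensor_sum N f \<and> v = tensor_sum N (\<lambda>k i. A i (f k i)))"

definition tensor_splines :: "nat \<Rightarrow> nat \<Rightarrow> (real ^ 'n::finite \<Rightarrow> real) set" where
  "tensor_splines p m = tensor_space (splines p m)"

definition tensor_proj :: "nat \<Rightarrow> nat \<Rightarrow> ('n \<Rightarrow> nat) \<Rightarrow>
    (real ^ 'n::finite \<Rightarrow> real) \<Rightarrow> real ^ 'n \<Rightarrow> real" where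
  "tensor_proj p m \<alpha> = tensor_op (splines p m) (\<lambda>i. spline_proj p m (\<alpha> i))"

definition unit_cube :: "(real ^ 'n::finite) set" where
  "unit_cube = {x. \<forall>i. 0 < x $ i \<and> x $ i < 1}"

(* Classical gradient. A tensor product spline is continuous and piecewise polynomial, so this is
   its weak gradient almost everywhere; for p = 1 the partial derivatives may fail to exist on the
   grid hyperplanes, a null set on which deriv takes some unspecified value. *)
definition gradient :: "(real ^ 'n::finite \<Rightarrow> real) \<Rightarrow> real ^ 'n \<Rightarrow> real ^ 'n" where
  "gradient u x = (\<chi> i. deriv (\<lambda>t. u (x + t *\<^sub>R axis i 1)) 0)"

definition L2_norm :: "(real ^ 'n::finite \<Rightarrow> 'b::real_normed_vector) \<Rightarrow> real" where
  "L2_norm u = sqrt (LINT x:unit_cube|lebesgue. (norm (u x))\<^sup>2)"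

definition H1_seminorm :: "(real ^ 'n::finite \<Rightarrow> real) \<Rightarrow> real" where
  "H1_seminorm u = L2_norm (gradient u)"

definition H1_norm :: "(real ^ 'n::finite \<Rightarrow> real) \<Rightarrow> real" where
  "H1_norm u = sqrt ((L2_norm u)\<^sup>2 + (H1_seminorm u)\<^sup>2)"

definition linear_op_on :: "(real \<Rightarrow> real) set \<Rightarrow> ((real \<Rightarrow> real) \<Rightarrow> real \<Rightarrow> real) \<Rightarrow> bool" where
  "linear_op_on V A \<longleftrightarrow> (\<forall>N c f. (\<forall>k<N. f k \<in> V) \<longrightarrow>
     A (\<lambda>t. \<Sum>k<N. c k * f k t) = (\<lambda>t. \<Sum>k<(N::nat). c k * A (f k) t))"

lemma tensor_sum_op_cong:
  fixes A :: "'n::finite \<Rightarrow> (real \<Rightarrow> real) \<Rightarrow> real \<Rightarrow> real"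
  assumes A: "\<And>i. linear_op_on V (A i)"
    and f: "\<And>k i. k < N \<Longrightarrow> f k i \<in> V" and g: "\<And>k i. k < M \<Longrightarrow> g k i \<in> V"
    and eq: "tensor_sum N f = tensor_sum M g"
  shows "tensor_sum N (\<lambda>k i. A i (f k i)) = tensor_sum M (\<lambda>k i. A i (g k i))"
proof -
  define B where "B J i w = (if i \<in> J then A i w else w)" for J i w
  have step: "tensor_sum N (\<lambda>k i. B J i (f k i)) = tensor_sum M (\<lambda>k i. B J i (g k i))" for J
  proof (induction J rule: finite_induct[OF finite])
    case 1
    show ?case using eq by (simp only: B_def empty_iff if_False)
  next
    case (2 a J)
    define c where "c h x k = (\<Prod>i\<in>UNIV - {a}. B J i (h k i) (x $ i))"
      for h :: "nat \<Rightarrow> 'n \<Rightarrow> real \<Rightarrow> real" and x k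
    have old: "tensor_sum L (\<lambda>k i. B J i (h k i)) (\<chi> i. if i = a then t else x $ i)
        = (\<Sum>k<L. c h x k * h k a t)" for L h x t
      unfolding tensor_sum_def
    proof (rule sum.cong[OF refl])
      fix k
      have "(\<Prod>i\<in>UNIV - {a}. B J i (h k i) ((\<chi> i. if i = a then t else x $ i) $ i)) = c h x k"
        unfolding c_def by (rule prod.cong) simp_all
      moreover have "B J a (h k a) ((\<chi> i. if i = a then t else x $ i) $ a) = h k a t"
        using 2(2) by (simp add: B_def)
      ultimately show "(\<Prod>i\<in>UNIV. B J i (h k i) ((\<chi> i. if i = a then t else x $ i) $ i))
          = c h x k * h k a t"
        by (subst prod.remove[OF finite UNIV_I, of _ a]) (simp only: mult.commute)
    qed
    have new: "tensor_sum L (\<lambda>k i. B (insert a J) i (h k i)) x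
        = (\<Sum>k<L. c h x k * A a (h k a) (x $ a))" for L h x
      unfolding tensor_sum_def
    proof (rule sum.cong[OF refl])
      fix k
      have "(\<Prod>i\<in>UNIV - {a}. B (insert a J) i (h k i) (x $ i)) = c h x k"
        unfolding c_def by (rule prod.cong) (simp_all add: B_def)
      moreover have "B (insert a J) a (h k a) (x $ a) = A a (h k a) (x $ a)"
        by (simp add: B_def)
      ultimately show "(\<Prod>i\<in>UNIV. B (insert a J) i (h k i) (x $ i))
          = c h x k * A a (h k a) (x $ a)"
        by (subst prod.remove[OF finite UNIV_I, of _ a]) (simp only: mult.commute)
    qed
    show ?case
    proof
      fix x
      have "(\<lambda>t. \<Sum>k<N. c f x k * f k a t) = (\<lambda>t. \<Sum>k<M. c g x k * g k a t)"
        (is "?l = ?r")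
      proof
        show "?l t = ?r t" for t
          using fun_cong[OF 2(3), of "\<chi> i. if i = a then t else x $ i"] unfolding old .
      qed
      then have "A a (\<lambda>t. \<Sum>k<N. c f x k * f k a t) = A a (\<lambda>t. \<Sum>k<M. c g x k * g k a t)"
        by (rule arg_cong)
      moreover have "A a (\<lambda>t. \<Sum>k<N. c f x k * f k a t) = (\<lambda>t. \<Sum>k<N. c f x k * A a (f k a) t)"
        using A[of a, unfolded linear_op_on_def, THEN spec[of _ N], THEN spec[of _ "c f x"],
          THEN spec[of _ "\<lambda>k. f k a"]] f by simp
      moreover have "A a (\<lambda>t. \<Sum>k<M. c g x k * g k a t) = (\<lambda>t. \<Sum>k<M. c g x k * A a (g k a) t)"
        using A[of a, unfolded linear_op_on_def, THEN spec[of _ M], THEN spec[of _ "c g x"],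
          THEN spec[of _ "\<lambda>k. g k a"]] g by simp
      ultimately show "tensor_sum N (\<lambda>k i. B (insert a J) i (f k i)) x
          = tensor_sum M (\<lambda>k i. B (insert a J) i (g k i)) x"
        unfolding new by (simp add: fun_eq_iff)
    qed
  qed
  show ?thesis using step[of UNIV] by (simp add: B_def)
qed

lemma tensor_op_tensor_sum:
  fixes A :: "'n::finite \<Rightarrow> (real \<Rightarrow> real) \<Rightarrow> real \<Rightarrow> real"
  assumes "\<And>i. linear_op_on V (A i)" and "\<And>k i. k < N \<Longrightarrow> f k i \<in> V"
  shows "tensor_op V A (tensor_sum N f) = tensor_sum N (\<lambda>k i. A i (f k i))"
  unfolding tensor_op_def
proof (rule the_equality)
  show "\<exists>M g. (\<forall>k<M. \<forall>i. g k i \<in> V) \<and> tensor_sum N f = tensor_sum M g \<and>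
      tensor_sum N (\<lambda>k i. A i (f k i)) = tensor_sum M (\<lambda>k i. A i (g k i))"
    by (rule exI[of _ N], rule exI[of _ f]) (simp add: assms(2))
next
  fix v
  assume "\<exists>M g. (\<forall>k<M. \<forall>i. g k i \<in> V) \<and> tensor_sum N f = tensor_sum M g \<and>
    v = tensor_sum M (\<lambda>k i. A i (g k i))"
  then obtain M g where g: "\<forall>k<M. \<forall>i. g k i \<in> V" and eq: "tensor_sum N f = tensor_sum M g"
    and v: "v = tensor_sum M (\<lambda>k i. A i (g k i))"
    by (elim exE conjE)
  show "v = tensor_sum N (\<lambda>k i. A i (f k i))"
    unfolding v by (rule tensor_sum_op_cong[OF assms(1) _ assms(2) eq[symmetric]]) (simp_all add: g)
qed

end

theory Submission
  imports Defs "HOL-Library.Function_Algebras"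
begin

text \<open>
  In one dimension the \<open>L\<^sub>2\<close>-projector \<open>Q\<^sub>0\<close> is stable in \<open>H\<^sup>1\<close>, uniformly in \<open>h\<close> and \<open>p\<close>: by symmetry
  the boundary terms \<open>u u'\<close> vanish on \<open>S\<^sub>0\<close>, so \<open>|u|\<^sub>1\<^sup>2 \<le> \<parallel>u\<parallel> \<parallel>u''\<parallel>\<close> and
  induction on the degree gives \<open>|u|\<^sub>1\<^sup>2 \<le> 12 h\<^bsup>-2\<^esup> \<parallel>u\<parallel>\<^sup>2\<close> there; and every \<open>u\<close> has an approximant
  \<open>v\<close> in \<open>S\<^sub>0\<close> with \<open>\<parallel>u - v\<parallel> \<le> 2 h |u|\<^sub>1\<close> and \<open>|v|\<^sub>1 \<le> |u|\<^sub>1\<close>, obtained by integrating the best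
  approximation of \<open>u'\<close> in the space of the opposite parity and one degree less; its error is
  controlled by duality, again by induction on the degree.

  In \<open>d\<close> dimensions \<open>\<parallel>\<partial>\<^sub>i u\<parallel>\<^sup>2\<close> is a product form with the energy in direction \<open>i\<close> and the
  \<open>L\<^sub>2\<close> form in the others. Summed over \<open>\<alpha>\<close>, the \<open>L\<^sub>2\<close> factors are reproduced exactly by
  orthogonality, and the one-dimensional inequality in direction \<open>i\<close> survives the multiplication
  with Gram matrices by the Schur product theorem.
\<close>

section \<open>Integrals of polynomials\<close>

lemma poly_integrable [simp]: "(poly (q :: real poly)) integrable_on {a..b}"
  by (intro integrable_continuous_interval continuous_intros)

lemma integral_poly_add:
  fixes q r :: "real poly"
  shows "integral {a..b} (poly (q + r)) = integral {a..b} (poly q) + integral {a..b} (poly r)"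
  using Henstock_Kurzweil_Integration.integral_add[of "poly q" "{a..b}" "poly r"] by (simp add: poly_add[abs_def])

lemma integral_poly_smult:
  "integral {a..b} (poly (smult c (q :: real poly))) = c * integral {a..b} (poly q)"
  by (simp add: poly_smult[abs_def])

lemma integral_poly_0 [simp]: "integral {a..b} (poly (0 :: real poly)) = 0"
  by (simp add: poly_0[abs_def])

lemma integral_poly_pderiv:
  "a \<le> b \<Longrightarrow> integral {a..b} (poly (pderiv q)) = poly q b - poly (q :: real poly) a"
  by (intro integral_unique fundamental_theorem_of_calculus)
    (auto simp: has_real_derivative_iff_has_vector_derivative[symmetric]
      intro!: has_field_derivative_at_within poly_DERIV)

lemma poly_cong_on_interval:
  fixes q r :: "real poly"
  assumes "a < b" "\<And>t. a < t \<Longrightarrow> t < b \<Longrightarrow> poly q t = poly r t"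
  shows "q = r"
proof (rule ccontr)
  assume "q \<noteq> r"
  then have "finite {t. poly (q - r) t = 0}"
    by (intro poly_roots_finite) simp
  moreover have "{a<..<b} \<subseteq> {t. poly (q - r) t = 0}"
    using assms(2) by auto
  ultimately show False
    using infinite_Ioo[OF assms(1)] finite_subset by blast
qed

lemma integral_poly_square_eq_0:
  fixes q :: "real poly"
  assumes "a < b" "integral {a..b} (poly (q * q)) = 0"
  shows "q = 0"
proof (rule poly_cong_on_interval[OF assms(1)])
  have "\<forall>t\<in>{a..b}. poly (q * q) t = 0"
    using assms by (subst integral_eq_0_iff[symmetric]) (auto intro!: continuous_intros)
  then show "poly q t = poly 0 t" if "a < t" "t < b" for t
    using that by simp
qed

lemma integral_poly_mono:
  fixes q r :: "real poly"
  assumes "\<And>t. t \<in> {a..b} \<Longrightarrow> poly q t \<le> poly r t"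
  shows "integral {a..b} (poly q) \<le> integral {a..b} (poly r)"
  by (rule integral_le) (use assms in auto)

section \<open>Antiderivatives and two inequalities on a single interval\<close>

definition poly_antideriv :: "real poly \<Rightarrow> real poly" where
  "poly_antideriv q = (\<Sum>i\<le>degree q. monom (coeff q i / real (Suc i)) (Suc i))"

lemma pderiv_poly_antideriv [simp]: "pderiv (poly_antideriv q) = q"
proof -
  have "pderiv (poly_antideriv q) = (\<Sum>i\<le>degree q. monom (coeff q i) i)"
    using higher_pderiv_sum[of 1 "\<lambda>i. monom (coeff q i / real (Suc i)) (Suc i)" "{..degree q}"]
    by (simp add: poly_antideriv_def pderiv_monom del: of_nat_Suc)
  then show ?thesis
    by (simp add: poly_as_sum_of_monoms)
qed

text \<open>The derivative of f^2 (t - b) integrates to zero, as \<open>f\<close> vanishes at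
  \<open>a\<close> and the weight at \<open>b\<close>. Young's inequality splits the mixed term so
  that half of the integral of f^2 is absorbed; doubling gives the factor 4.\<close>

lemma poly_square_le_pderiv:
  fixes f :: "real poly"
  assumes "a \<le> b" "poly f a = 0"
  shows "integral {a..b} (poly (f * f)) \<le> 4 * (b - a)\<^sup>2 * integral {a..b} (poly (pderiv f * pderiv f))"
proof -
  define L where "L = [:-b, 1:]"
  have "integral {a..b} (poly (pderiv (f * f * L))) = 0"
    using assms by (simp add: integral_poly_pderiv L_def)
  moreover have "pderiv (f * f * L) = f * f + smult 2 (f * pderiv f * L)"
  proof -
    have "pderiv L = 1"
      by (simp add: L_def pderiv_pCons)
    then show ?thesis
      by (intro poly_eq_poly_eq_iff[THEN iffD1] ext) (simp add: pderiv_mult algebra_simps)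
  qed
  ultimately have "integral {a..b} (poly (f * f)) = integral {a..b} (poly (smult (-2) (f * pderiv f * L)))"
    by (simp only: integral_poly_add integral_poly_smult)
  also have "\<dots> \<le> integral {a..b} (poly (smult (1/2) (f * f) + smult (2 * (b - a)\<^sup>2) (pderiv f * pderiv f)))"
  proof (rule integral_poly_mono)
    fix t assume t: "t \<in> {a..b}"
    define x y s where "x = poly f t" and "y = poly (pderiv f) t" and "s = b - t"
    have "s\<^sup>2 \<le> (b - a)\<^sup>2"
      using t by (auto simp: s_def intro!: power_mono)
    then have "y\<^sup>2 * s\<^sup>2 \<le> y\<^sup>2 * (b - a)\<^sup>2"
      by (intro mult_left_mono) auto
    moreover have "0 \<le> (x - 2 * (y * s))\<^sup>2"
      by simp
    ultimately have "2 * x * y * s \<le> 1/2 * (x * x) + 2 * (b - a)\<^sup>2 * (y * y)"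
      by (simp add: power2_eq_square algebra_simps)
    then show "poly (smult (-2) (f * pderiv f * L)) t
        \<le> poly (smult (1/2) (f * f) + smult (2 * (b - a)\<^sup>2) (pderiv f * pderiv f)) t"
      by (simp add: L_def x_def y_def s_def algebra_simps)
  qed
  finally show ?thesis
    by (simp add: integral_poly_add integral_poly_smult)
qed

text \<open>Base case of the inverse inequality. About the midpoint an affine function splits into a
  constant and an odd part, so its squared norm dominates that of the odd part.\<close>

lemma affine_pderiv_le:
  fixes f :: "real poly"
  assumes "a < b" "degree f \<le> 1"
  shows "integral {a..b} (poly (pderiv f * pderiv f)) \<le> 12 / (b - a)\<^sup>2 * integral {a..b} (poly (f * f))"
proof -
  obtain \<alpha> \<beta> where f: "f = [:\<alpha>, \<beta>:]"
    using degree1_coeffs[of f] assms(2) 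
    by (metis One_nat_def degree_eq_zeroE le_Suc_eq le_zero_eq pCons_0_0)
  have df: "pderiv f = [:\<beta>:]"
    by (simp add: f pderiv_pCons)
  have 1: "integral {a..b} (poly (pderiv f * pderiv f)) = (b - a) * \<beta>\<^sup>2"
    using assms(1) integral_poly_pderiv[of a b "[:0, \<beta>\<^sup>2:]"]
    by (simp add: df power2_eq_square pderiv_pCons left_diff_distrib)
  define F where "F = [:0, \<alpha>\<^sup>2, \<alpha> * \<beta>, \<beta>\<^sup>2 / 3:]"
  have "pderiv F = f * f"
    by (simp add: F_def f pderiv_pCons power2_eq_square)
  then have "integral {a..b} (poly (f * f)) = poly F b - poly F a"
    using integral_poly_pderiv[of a b F] assms(1) by simp
  also have "\<dots> = (b - a) * (\<alpha> + \<beta> * (a + b) / 2)\<^sup>2 + \<beta>\<^sup>2 * (b - a) * (b - a)\<^sup>2 / 12"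
    by (simp add: F_def field_simps power2_eq_square)
  also have "\<dots> \<ge> \<beta>\<^sup>2 * (b - a) * (b - a)\<^sup>2 / 12"
    using assms(1) by simp
  finally show ?thesis
    unfolding 1 using assms(1) by (simp add: field_simps)
qed

section \<open>Splines as families of polynomial pieces\<close>

text \<open>Piece \<open>j < m\<close> lives on \<open>[node m j, node m (Suc j)]\<close>.\<close>

definition node :: "nat \<Rightarrow> nat \<Rightarrow> real" where
  "node m j = real j / real m"

definition pw_scale :: "real \<Rightarrow> (nat \<Rightarrow> real poly) \<Rightarrow> nat \<Rightarrow> real poly" where
  "pw_scale c q = (\<lambda>j. smult c (q j))"

definition pw_inner :: "nat \<Rightarrow> (nat \<Rightarrow> real poly) \<Rightarrow> (nat \<Rightarrow> real poly) \<Rightarrow> real" where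
  "pw_inner m q r = (\<Sum>j<m. integral {node m j..node m (Suc j)} (poly (q j * r j)))"

definition pw_deriv :: "(nat \<Rightarrow> real poly) \<Rightarrow> nat \<Rightarrow> real poly" where
  "pw_deriv q = (\<lambda>j. pderiv (q j))"

abbreviation pw_energy :: "nat \<Rightarrow> (nat \<Rightarrow> real poly) \<Rightarrow> (nat \<Rightarrow> real poly) \<Rightarrow> real" where
  "pw_energy m q r \<equiv> pw_inner m (pw_deriv q) (pw_deriv r)"

text \<open>The number \<open>n\<close> counts matching derivatives including order 0, so it stands
  for C^(n-1); \<open>n = 0\<close> imposes nothing.\<close>

definition pw_smooth :: "nat \<Rightarrow> nat \<Rightarrow> (nat \<Rightarrow> real poly) \<Rightarrow> bool" where
  "pw_smooth n m q \<longleftrightarrow> (\<forall>j i. Suc j < m \<longrightarrow> i < n \<longrightarrow>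
     poly ((pderiv ^^ i) (q j)) (node m (Suc j)) = poly ((pderiv ^^ i) (q (Suc j))) (node m (Suc j)))"

text \<open>Pieces from index \<open>m\<close> on are set to zero so that equal splines have equal
  families.\<close>

definition spline_pieces :: "nat \<Rightarrow> nat \<Rightarrow> (nat \<Rightarrow> real poly) set" where
  "spline_pieces p m = {q. (\<forall>j<m. degree (q j) \<le> p) \<and> (\<forall>j\<ge>m. q j = 0) \<and> pw_smooth p m q}"

text \<open>The parity is a parameter since differentiation switches it; \<open>e = 1\<close> is the space \<open>S\<^sub>0\<close>.\<close>

definition sym_pieces :: "nat \<Rightarrow> nat \<Rightarrow> nat \<Rightarrow> (nat \<Rightarrow> real poly) set" where
  "sym_pieces e p m = {q \<in> spline_pieces p m. \<forall>i<p. even (i + e) \<longrightarrow>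
     poly ((pderiv ^^ i) (q 0)) 0 = 0 \<and> poly ((pderiv ^^ i) (q (m - 1))) 1 = 0}"

text \<open>Makes spans, bases and dimension bounds available for families of pieces, with pointwise
  addition.\<close>

interpretation pieces: vector_space pw_scale
  by unfold_locales (auto simp: pw_scale_def fun_eq_iff smult_add_right smult_add_left)

lemma node_simps [simp]: "node m 0 = 0" "m > 0 \<Longrightarrow> node m m = 1"
  "m > 0 \<Longrightarrow> node m j < node m (Suc j)" "m > 0 \<Longrightarrow> node m j \<le> node m (Suc j)"
  by (auto simp: node_def divide_strict_right_mono divide_right_mono)

lemma node_diff: "node m (Suc j) - node m j = 1 / real m"
  by (simp add: node_def diff_divide_distrib[symmetric])

section \<open>The \<open>L\<^sub>2\<close> form and integration by parts\<close>

lemma pw_inner_commute: "pw_inner m q r = pw_inner m r q"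
  by (simp add: pw_inner_def mult.commute)

lemma pw_inner_add_left: "pw_inner m (q + r) s = pw_inner m q s + pw_inner m r s"
  by (simp add: pw_inner_def distrib_right integral_poly_add sum.distrib del: poly_add poly_mult)

lemma pw_inner_scale_left: "pw_inner m (pw_scale c q) s = c * pw_inner m q s"
  by (simp add: pw_inner_def pw_scale_def integral_poly_smult sum_distrib_left)

lemma pw_inner_add_right: "pw_inner m s (q + r) = pw_inner m s q + pw_inner m s r"
  by (metis pw_inner_commute pw_inner_add_left)

lemma pw_inner_scale_right: "pw_inner m s (pw_scale c q) = c * pw_inner m s q"
  by (metis pw_inner_commute pw_inner_scale_left)

lemma pw_inner_diff_left: "pw_inner m (q - r) s = pw_inner m q s - pw_inner m r s"
  using pw_inner_add_left[of m "q - r" r s] by simp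

lemma pw_inner_diff_right: "pw_inner m s (q - r) = pw_inner m s q - pw_inner m s r"
  by (metis pw_inner_commute pw_inner_diff_left)

lemmas pw_inner_simps = pw_inner_add_left pw_inner_add_right pw_inner_diff_left pw_inner_diff_right
  pw_inner_scale_left pw_inner_scale_right

lemma pw_inner_nonneg [simp]: "0 \<le> pw_inner m q q"
  unfolding pw_inner_def by (intro sum_nonneg integral_nonneg poly_integrable) simp

lemma pw_inner_eq_0:
  assumes "pw_inner m q q = 0" "j < m"
  shows "q j = 0"
proof -
  have "\<forall>j\<in>{..<m}. integral {node m j..node m (Suc j)} (poly (q j * q j)) = 0"
    using assms(1) unfolding pw_inner_def
    by (subst (asm) sum_nonneg_eq_0_iff) (auto intro: integral_nonneg[OF poly_integrable])
  then show ?thesis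
    using assms(2) by (intro integral_poly_square_eq_0[of "node m j" "node m (Suc j)"] node_simps(3)) auto
qed

lemma pw_inner_add_sq: "pw_inner m (q + r) (q + r) \<le> 2 * pw_inner m q q + 2 * pw_inner m r r"
  using pw_inner_nonneg[of m "q - r"] by (simp add: pw_inner_simps)

text \<open>Divide the squares of s q + r and s q - r by \<open>s\<close>. The weight will be the
  constant of an inverse or approximation estimate, so that the last term can be absorbed.\<close>

lemma pw_inner_young:
  assumes "s > 0"
  shows "2 * \<bar>pw_inner m q r\<bar> \<le> s * pw_inner m q q + pw_inner m r r / s"
proof -
  have "0 \<le> pw_inner m (pw_scale s q + r) (pw_scale s q + r)" "0 \<le> pw_inner m (pw_scale s q - r) (pw_scale s q - r)"
    by simp_all
  then have "0 \<le> s * s * pw_inner m q q + 2 * s * pw_inner m q r + pw_inner m r r"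
    "0 \<le> s * s * pw_inner m q q - 2 * s * pw_inner m q r + pw_inner m r r"
    by (simp_all add: pw_inner_simps pw_inner_commute[of m r q] algebra_simps)
  then show ?thesis
    using assms by (simp add: field_simps abs_if)
qed

lemma pw_deriv_linear:
  "pw_deriv (q + r) = pw_deriv q + pw_deriv r" "pw_deriv (q - r) = pw_deriv q - pw_deriv r"
  "pw_deriv (pw_scale c q) = pw_scale c (pw_deriv q)" "pw_deriv 0 = 0"
  by (auto simp: pw_deriv_def pw_scale_def fun_eq_iff pderiv_add pderiv_diff pderiv_smult)

text \<open>The product rule on each piece and a telescoping sum; positive smoothness orders make
  both functions continuous, so the contributions of interior nodes cancel.\<close>

lemma pw_inner_by_parts:
  assumes m: "m > 0" and n: "n > 0" "k > 0" and q: "pw_smooth n m q" and r: "pw_smooth k m r"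
  shows "pw_inner m (pw_deriv q) r + pw_inner m q (pw_deriv r) =
    poly (q (m - 1)) 1 * poly (r (m - 1)) 1 - poly (q 0) 0 * poly (r 0) 0"
proof -
  define g where "g j = poly (q j) (node m j) * poly (r j) (node m j)" for j
  \<comment> \<open>At \<open>j = m\<close> the end value must come from the last piece
    \<open>m - 1\<close>.\<close>
  define h where "h j = (if j < m then g j else poly (q (m - 1)) 1 * poly (r (m - 1)) 1)" for j
  have "pw_inner m (pw_deriv q) r + pw_inner m q (pw_deriv r)
      = (\<Sum>j<m. integral {node m j..node m (Suc j)} (poly (pderiv (q j * r j))))"
    unfolding pw_inner_def pw_deriv_def sum.distrib[symmetric] integral_poly_add[symmetric]
    by (simp add: pderiv_mult algebra_simps)
  also have "\<dots> = (\<Sum>j<m. h (Suc j) - h j)"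
  proof (rule sum.cong[OF refl])
    fix j assume j: "j \<in> {..<m}"
    have "poly (q j * r j) (node m (Suc j)) = h (Suc j)"
    proof (cases "Suc j < m")
      case True
      then show ?thesis
        using q[unfolded pw_smooth_def, rule_format, of j 0] r[unfolded pw_smooth_def, rule_format, of j 0] n
        by (simp add: h_def g_def)
    next
      case False
      then have "Suc j = m" using j by simp
      then show ?thesis using m by (auto simp: h_def)
    qed
    then show "integral {node m j..node m (Suc j)} (poly (pderiv (q j * r j))) = h (Suc j) - h j"
      using j m by (simp add: integral_poly_pderiv h_def g_def)
  qed
  also have "\<dots> = h m - h 0"
    by (simp add: sum_lessThan_telescope)
  finally show ?thesis
    using m by (simp add: h_def g_def)
qed

section \<open>Inverse inequality and approximation\<close>

lemma higher_pderiv_diff: "(pderiv ^^ n) (q - r :: real poly) = (pderiv ^^ n) q - (pderiv ^^ n) r"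
  by (induction n) (simp_all add: pderiv_diff)

lemma pw_smooth_mono: "pw_smooth n m q \<Longrightarrow> k \<le> n \<Longrightarrow> pw_smooth k m q"
  by (simp add: pw_smooth_def)

lemma pw_smooth_linear:
  "pw_smooth n m q \<Longrightarrow> pw_smooth n m r \<Longrightarrow> pw_smooth n m (q + r)"
  "pw_smooth n m q \<Longrightarrow> pw_smooth n m r \<Longrightarrow> pw_smooth n m (q - r)"
  "pw_smooth n m q \<Longrightarrow> pw_smooth n m (pw_scale c q)"
  by (simp_all add: pw_smooth_def pw_scale_def higher_pderiv_add higher_pderiv_diff higher_pderiv_smult)

section \<open>Finite dimension and existence of orthogonal projections\<close>

lemma subspace_spline_pieces: "pieces.subspace (spline_pieces p m)"
  unfolding pieces.subspace_def
  by (auto simp: spline_pieces_def pw_smooth_def pw_scale_def higher_pderiv_add higher_pderiv_smult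
      intro: degree_add_le order_trans[OF degree_smult_le])

lemma subspace_sym_pieces: "pieces.subspace (sym_pieces e p m)"
  using subspace_spline_pieces[of p m]
  unfolding pieces.subspace_def
  by (auto simp: sym_pieces_def pw_scale_def higher_pderiv_add higher_pderiv_smult)

lemma sym_pieces_subset: "q \<in> sym_pieces e p m \<Longrightarrow> q \<in> spline_pieces p m"
  by (simp add: sym_pieces_def)

lemma spline_pieces_zero: "q \<in> spline_pieces p m \<Longrightarrow> j \<ge> m \<Longrightarrow> q j = 0"
  by (simp add: spline_pieces_def)

lemma spline_pieces_smooth: "q \<in> spline_pieces p m \<Longrightarrow> pw_smooth p m q"
  by (simp add: spline_pieces_def)

lemma pw_inner_zero [simp]: "pw_inner m q 0 = 0" "pw_inner m 0 q = 0"
  using pw_inner_diff_right[of m q 0 0] pw_inner_diff_left[of m 0 0 q] by auto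

lemma finite_span_spline_pieces:
  obtains B where "finite B" "spline_pieces p m \<subseteq> pieces.span B"
proof
  define b :: "nat \<Rightarrow> nat \<Rightarrow> nat \<Rightarrow> real poly" where "b j k = (\<lambda>l. if l = j then monom 1 k else 0)" for j k
  define B where "B = (\<lambda>(j, k). b j k) ` ({..<m} \<times> {..p})"
  show "finite B"
    by (simp add: B_def)
  show "spline_pieces p m \<subseteq> pieces.span B"
  proof
    fix q assume q: "q \<in> spline_pieces p m"
    have "q = (\<Sum>j<m. \<Sum>k\<le>p. pw_scale (coeff (q j) k) (b j k))"
    proof
      fix l
      have ev: "sum F A l = (\<Sum>x\<in>A. F x l)" for A :: "nat set" and F :: "nat \<Rightarrow> nat \<Rightarrow> real poly"
        by (induction A rule: infinite_finite_induct) auto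
      have "(\<Sum>j<m. \<Sum>k\<le>p. pw_scale (coeff (q j) k) (b j k)) l
          = (\<Sum>j<m. if l = j then \<Sum>k\<le>p. monom (coeff (q j) k) k else 0)"
        unfolding ev by (intro sum.cong) (auto simp: pw_scale_def b_def smult_monom)
      also have "\<dots> = (if l < m then \<Sum>k\<le>p. monom (coeff (q l) k) k else 0)"
        by simp
      also have "\<dots> = q l"
        using q by (auto simp: spline_pieces_def poly_as_sum_of_monoms')
      finally show "q l = (\<Sum>j<m. \<Sum>k\<le>p. pw_scale (coeff (q j) k) (b j k)) l" ..
    qed
    also have "\<dots> \<in> pieces.span B"
      by (intro pieces.span_sum pieces.span_scale pieces.span_base) (auto simp: B_def)
    finally show "q \<in> pieces.span B" .
  qed
qed

text \<open>Gram-Schmidt: \<open>b\<close> is replaced by its component \<open>b'\<close> orthogonal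
  to the earlier span, and a multiple of \<open>b'\<close> is added to the projection onto that
  span.\<close>

lemma orthogonal_proj_span:
  assumes "finite B"
  shows "\<exists>v\<in>pieces.span B. \<forall>w\<in>pieces.span B. pw_inner m (u - v) w = 0"
  using assms
proof (induction B arbitrary: u rule: finite_induct)
  case empty
  then show ?case
    by (intro bexI[of _ 0] ballI) (simp_all only: pieces.span_empty pw_inner_zero singleton_iff)
next
  case (insert b B)
  obtain Pu where Pu: "Pu \<in> pieces.span B" "\<And>w. w \<in> pieces.span B \<Longrightarrow> pw_inner m (u - Pu) w = 0"
    using insert.IH[of u] by blast
  obtain Pb where Pb: "Pb \<in> pieces.span B" "\<And>w. w \<in> pieces.span B \<Longrightarrow> pw_inner m (b - Pb) w = 0"
    using insert.IH[of b] by blast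
  define b' where "b' = b - Pb"
  \<comment> \<open>If \<open>b'\<close> has norm zero the quotient is 0 by convention; then
    \<open>b'\<close> vanishes on all pieces below \<open>m\<close> and the equation for
    \<open>c\<close> still holds.\<close>
  define c where "c = pw_inner m (u - Pu) b' / pw_inner m b' b'"
  have c: "pw_inner m (u - Pu) b' = c * pw_inner m b' b'"
  proof (cases "pw_inner m b' b' = 0")
    case True
    have "b' j = 0" if "j < m" for j
      using pw_inner_eq_0[OF True that] .
    then have "pw_inner m (u - Pu) b' = 0"
      by (simp add: pw_inner_def)
    then show ?thesis using True by simp
  qed (simp add: c_def)
  have sub: "w \<in> pieces.span (insert b B)" if "w \<in> pieces.span B" for w
    using that pieces.span_mono[of B "insert b B"] by auto
  show ?case
  proof (intro bexI ballI)
    show "Pu + pw_scale c b' \<in> pieces.span (insert b B)"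
      unfolding b'_def using Pu(1) Pb(1)
      by (intro pieces.span_add pieces.span_scale pieces.span_diff sub pieces.span_base[of b]) auto
    fix w assume "w \<in> pieces.span (insert b B)"
    then obtain k where k: "w - pw_scale k b \<in> pieces.span B"
      using pieces.span_breakdown_eq by blast
    define w' where "w' = w - pw_scale k b + pw_scale k Pb"
    have w': "w' \<in> pieces.span B" "w = w' + pw_scale k b'"
      using k Pb(1) by (auto simp: w'_def b'_def intro!: pieces.span_add pieces.span_scale)
        (simp add: pw_scale_def fun_eq_iff smult_diff_right)
    have "pw_inner m (u - Pu) w' = 0" "pw_inner m b' w' = 0"
      using Pu Pb w'(1) by (auto simp: b'_def)
    then show "pw_inner m (u - (Pu + pw_scale c b')) w = 0"
      using c unfolding w'(2) by (simp add: pw_inner_simps algebra_simps)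
  qed
qed

text \<open>The subspace has a basis inside a finitely generated space, hence a finite one. The
  family \<open>u\<close> is arbitrary, since the derivatives projected later need not be
  splines.\<close>

lemma orthogonal_proj_sym:
  "\<exists>v\<in>sym_pieces e p m. \<forall>w\<in>sym_pieces e p m. pw_inner m (u - v) w = 0"
proof -
  obtain A where A: "finite A" "spline_pieces p m \<subseteq> pieces.span A"
    using finite_span_spline_pieces .
  obtain B where B: "B \<subseteq> sym_pieces e p m" "pieces.independent B" "sym_pieces e p m \<subseteq> pieces.span B"
    using pieces.basis_exists by metis
  have "B \<subseteq> pieces.span A"
    using A(2) B(1) sym_pieces_subset by blast
  then have "finite B"
    using pieces.independent_span_bound[OF A(1) B(2)] by simp
  moreover have "pieces.span B = sym_pieces e p m"
    using B pieces.span_minimal[OF B(1) subspace_sym_pieces] by auto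
  ultimately show ?thesis
    using orthogonal_proj_span[of B m u] by simp
qed

section \<open>Constants, antiderivatives and the shift of degree and parity\<close>

definition pw_one :: "nat \<Rightarrow> nat \<Rightarrow> real poly" where
  "pw_one m = (\<lambda>j. if j < m then 1 else 0)"

lemma pw_deriv_one [simp]: "pw_deriv (pw_one m) = 0"
  by (auto simp: pw_deriv_def pw_one_def)

lemma higher_pderiv_one: "0 < i \<Longrightarrow> (pderiv ^^ i) (1 :: real poly) = 0"
  by (cases i) (simp_all add: funpow_Suc_right del: funpow.simps)

lemma pw_one_smooth: "pw_smooth n m (pw_one m)"
  by (simp add: pw_smooth_def pw_one_def)

text \<open>For odd \<open>e\<close> only derivatives of odd order are constrained, and these
  annihilate constants.\<close>

lemma pw_one_sym: "odd e \<Longrightarrow> pw_one m \<in> sym_pieces e p m"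
proof -
  assume "odd e"
  then have pos: "0 < i" if "even (i + e)" for i
    using that by (cases i) auto
  show ?thesis
    unfolding sym_pieces_def
  proof (intro CollectI conjI allI impI)
    show "pw_one m \<in> spline_pieces p m"
      by (simp add: spline_pieces_def pw_one_smooth) (simp add: pw_one_def)
    fix i assume "even (i + e)"
    then have "poly ((pderiv ^^ i) (pw_one m j)) x = 0" for j x
      using pos[of i] by (simp add: pw_one_def higher_pderiv_one)
    then show "poly ((pderiv ^^ i) (pw_one m 0)) 0 = 0" "poly ((pderiv ^^ i) (pw_one m (m - 1))) 1 = 0"
      by simp_all
  qed
qed

lemma pw_inner_one: "m > 0 \<Longrightarrow> pw_inner m (pw_one m) (pw_one m) = 1"
proof -
  assume m: "m > 0"
  have "integral {node m j..node m (Suc j)} (poly 1) = 1 / m" for j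
    using m integral_poly_pderiv[of "node m j" "node m (Suc j)" "[:0, 1:]"]
    by (simp add: pderiv_pCons node_diff one_pCons)
  then show ?thesis
    using m by (simp add: pw_inner_def pw_one_def)
qed

text \<open>Integration constants determined from left to right: the first makes the antiderivative
  vanish at 0, the others make it continuous at the nodes.\<close>

fun antideriv_const :: "nat \<Rightarrow> (nat \<Rightarrow> real poly) \<Rightarrow> nat \<Rightarrow> real" where
  "antideriv_const m q 0 = - poly (poly_antideriv (q 0)) 0"
| "antideriv_const m q (Suc j) = antideriv_const m q j
     + poly (poly_antideriv (q j)) (node m (Suc j)) - poly (poly_antideriv (q (Suc j))) (node m (Suc j))"

definition pw_antideriv :: "nat \<Rightarrow> (nat \<Rightarrow> real poly) \<Rightarrow> nat \<Rightarrow> real poly" where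
  "pw_antideriv m q = (\<lambda>j. if j < m then poly_antideriv (q j) + [:antideriv_const m q j:] else 0)"

lemma pw_antideriv_zero: "j \<ge> m \<Longrightarrow> pw_antideriv m q j = 0"
  by (simp add: pw_antideriv_def)

lemma pw_deriv_antideriv:
  assumes "\<And>j. j \<ge> m \<Longrightarrow> q j = 0"
  shows "pw_deriv (pw_antideriv m q) = q"
  using assms by (auto simp: pw_deriv_def pw_antideriv_def fun_eq_iff pderiv_add pderiv_pCons)

lemma pw_antideriv_smooth: "pw_smooth 1 m (pw_antideriv m q)"
  by (auto simp: pw_smooth_def pw_antideriv_def)

lemma pw_antideriv_at_0: "m > 0 \<Longrightarrow> poly (pw_antideriv m q 0) 0 = 0"
  by (simp add: pw_antideriv_def)

text \<open>Integration by parts against the constant one. It converts orthogonality to constants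
  into a vanishing boundary value at 1.\<close>

lemma pw_at_1:
  assumes "m > 0" "pw_smooth 1 m q" "poly (q 0) 0 = 0"
  shows "poly (q (m - 1)) 1 = pw_inner m (pw_deriv q) (pw_one m)"
proof -
  have "poly (pw_one m (m - 1)) 1 = 1"
    using assms(1) by (simp add: pw_one_def)
  then show ?thesis
    using pw_inner_by_parts[OF assms(1) _ _ assms(2) pw_one_smooth, of 1] assms(1,3) by simp
qed

lemma higher_pderiv_pw_deriv: "(pderiv ^^ i) (pw_deriv q j) = (pderiv ^^ Suc i) (q j)"
  by (simp add: pw_deriv_def funpow_Suc_right del: funpow.simps)

lemma pw_deriv_spline:
  assumes "q \<in> spline_pieces (Suc p) m"
  shows "pw_deriv q \<in> spline_pieces p m"
  using assms
  by (auto simp: spline_pieces_def pw_smooth_def higher_pderiv_pw_deriv simp del: funpow.simps)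
    (auto simp: pw_deriv_def degree_pderiv)

text \<open>A condition on order \<open>i\<close> of the derivative is one on order
  \<open>i + 1\<close> of the function, which shifts the parity.\<close>

lemma pw_deriv_sym:
  assumes "q \<in> sym_pieces e (Suc p) m"
  shows "pw_deriv q \<in> sym_pieces (Suc e) p m"
  using assms pw_deriv_spline[of q p m]
  by (auto simp: sym_pieces_def higher_pderiv_pw_deriv simp del: funpow.simps)

lemma spline_SucI:
  assumes "\<And>j. j \<ge> m \<Longrightarrow> q j = 0" "pw_smooth 1 m q" "pw_deriv q \<in> spline_pieces p m"
  shows "q \<in> spline_pieces (Suc p) m"
proof -
  have "pw_smooth (Suc p) m q"
    unfolding pw_smooth_def
  proof (intro allI impI)
    fix j i assume "Suc j < m" "i < Suc p"
    then show "poly ((pderiv ^^ i) (q j)) (node m (Suc j)) = poly ((pderiv ^^ i) (q (Suc j))) (node m (Suc j))"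
      using assms(2,3) unfolding spline_pieces_def pw_smooth_def
      by (cases i) (auto simp: higher_pderiv_pw_deriv simp del: funpow.simps(2))
  qed
  moreover have "degree (q j) \<le> Suc p" if "j < m" for j
    using assms(3) that by (auto simp: spline_pieces_def pw_deriv_def degree_pderiv)
  ultimately show ?thesis
    using assms(1) by (simp add: spline_pieces_def)
qed

text \<open>Conditions of positive order come from the derivative. Only order zero remains:
  continuity, and zero boundary values for even \<open>e\<close>.\<close>

lemma sym_SucI:
  assumes "\<And>j. j \<ge> m \<Longrightarrow> q j = 0" "pw_smooth 1 m q" "pw_deriv q \<in> sym_pieces (Suc e) p m"
    "even e \<Longrightarrow> poly (q 0) 0 = 0 \<and> poly (q (m - 1)) 1 = 0"
  shows "q \<in> sym_pieces e (Suc p) m"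
  unfolding sym_pieces_def
proof (intro CollectI conjI allI impI)
  show "q \<in> spline_pieces (Suc p) m"
    using assms sym_pieces_subset by (intro spline_SucI) auto
  fix i assume "i < Suc p" "even (i + e)"
  then show "poly ((pderiv ^^ i) (q 0)) 0 = 0" "poly ((pderiv ^^ i) (q (m - 1))) 1 = 0"
    using assms(3,4) unfolding sym_pieces_def
    by (cases i; auto simp: higher_pderiv_pw_deriv simp del: funpow.simps(2))+
qed

text \<open>The boundary terms of the integration by parts vanish by symmetry, so
  \<open>|q'|\<^sup>2 = - \<langle>q, q''\<rangle>\<close>, and the bound for \<open>q'\<close> in terms of \<open>q''\<close> carries over to \<open>q\<close>.\<close>

lemma sym_inverse_inequality:
  assumes m: "m > 0" and q: "q \<in> sym_pieces e (Suc p) m"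
  shows "pw_energy m q q \<le> 12 * (real m)\<^sup>2 * pw_inner m q q"
  using q
proof (induction p arbitrary: e q)
  case 0
  \<comment> \<open>The induction starts at degree one, where the estimate holds separately on each
    interval of length \<open>1 / m\<close>.\<close>
  have "integral {node m j..node m (Suc j)} (poly (pw_deriv q j * pw_deriv q j))
      \<le> 12 * (real m)\<^sup>2 * integral {node m j..node m (Suc j)} (poly (q j * q j))" if "j < m" for j
    using affine_pderiv_le[of "node m j" "node m (Suc j)" "q j"] 0 that m
    by (auto simp: pw_deriv_def node_diff sym_pieces_def spline_pieces_def power_divide)
  then show ?case
    unfolding pw_inner_def sum_distrib_left by (intro sum_mono) auto
next
  case (Suc p)
  let ?A = "pw_inner m q q" and ?B = "pw_energy m q q" and ?C = "pw_energy m (pw_deriv q) (pw_deriv q)"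
  define s where "s = 12 * (real m)\<^sup>2"
  have s: "s > 0" using m by (simp add: s_def)
  have d: "pw_deriv q \<in> sym_pieces (Suc e) (Suc p) m"
    using pw_deriv_sym[OF Suc.prems] .
  \<comment> \<open>Even parity makes \<open>q\<close> vanish at both ends, odd parity its
    derivative.\<close>
  have bd: "poly (q 0) 0 * poly (pw_deriv q 0) 0 = 0 \<and> poly (q (m - 1)) 1 * poly (pw_deriv q (m - 1)) 1 = 0"
  proof (cases "even e")
    case True
    then show ?thesis
      using Suc.prems[unfolded sym_pieces_def] by (auto dest: spec[of _ 0])
  next
    case False
    then show ?thesis
      using d[unfolded sym_pieces_def] by (auto dest: spec[of _ 0])
  qed
  have "?B + pw_inner m q (pw_deriv (pw_deriv q)) = 0"
    using pw_inner_by_parts[OF m _ _ spline_pieces_smooth[OF sym_pieces_subset[OF Suc.prems]]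
        spline_pieces_smooth[OF sym_pieces_subset[OF d]]] bd by simp
  \<comment> \<open>The weight is the target constant, so the induction hypothesis bounds
    \<open>?C / s\<close> by \<open>?B\<close>; then 2 B \<le> s A + B yields the same constant in
    every degree.\<close>
  moreover have "2 * \<bar>pw_inner m q (pw_deriv (pw_deriv q))\<bar> \<le> s * ?A + ?C / s"
    using pw_inner_young[OF s] .
  moreover have "?C / s \<le> ?B"
    using Suc.IH[OF d] s by (simp add: s_def field_simps)
  ultimately show ?case
    by (simp add: s_def)
qed

text \<open>Duality: the degree is raised by integrating the best approximation of the derivative, and
  the error of the new approximation is estimated by applying the old estimate to an antiderivative
  of that error.\<close>

lemma sym_approximation:
  assumes m: "m > 0"
    and z: "\<And>j. j \<ge> m \<Longrightarrow> z j = 0" "pw_smooth 1 m z"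
      "even e \<Longrightarrow> poly (z 0) 0 = 0 \<and> poly (z (m - 1)) 1 = 0"
  shows "\<exists>v\<in>sym_pieces e p m. pw_inner m (z - v) (z - v) \<le> 4 / (real m)\<^sup>2 * pw_energy m z z \<and>
    (0 < p \<longrightarrow> pw_energy m v v \<le> pw_energy m z z)"
  using z
proof (induction p arbitrary: e z)
  case 0
  \<comment> \<open>Degree zero imposes neither continuity nor boundary conditions, so each piece
    may take the value of \<open>z\<close> at its left node, where \<open>z - v\<close> then
    vanishes.\<close>
  define v where "v j = (if j < m then [:poly (z j) (node m j):] else 0)" for j
  have "v \<in> sym_pieces e 0 m"
    by (simp add: sym_pieces_def spline_pieces_def pw_smooth_def v_def)
  moreover have "integral {node m j..node m (Suc j)} (poly ((z - v) j * (z - v) j))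
      \<le> 4 / (real m)\<^sup>2 * integral {node m j..node m (Suc j)} (poly (pw_deriv z j * pw_deriv z j))"
    if "j < m" for j
    using poly_square_le_pderiv[of "node m j" "node m (Suc j)" "z j - v j"] that m
    by (simp add: node_diff v_def pw_deriv_def pderiv_diff pderiv_pCons power_divide)
  then have "pw_inner m (z - v) (z - v) \<le> 4 / (real m)\<^sup>2 * pw_energy m z z"
    unfolding pw_inner_def sum_distrib_left by (intro sum_mono) auto
  ultimately show ?case
    by blast
next
  case (Suc p)
  define f where "f = pw_deriv z"
  obtain r where r: "r \<in> sym_pieces (Suc e) p m" "\<And>w. w \<in> sym_pieces (Suc e) p m \<Longrightarrow> pw_inner m (f - r) w = 0"
    using orthogonal_proj_sym by blast
  define g where "g = f - r"
  have g0: "g j = 0" if "j \<ge> m" for j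
    using that Suc.prems(1) spline_pieces_zero[OF sym_pieces_subset[OF r(1)]] by (simp add: g_def f_def pw_deriv_def)
  \<comment> \<open>For odd \<open>e\<close> the free constant gives \<open>w\<close> mean zero; for
    even \<open>e\<close> it is zero so that \<open>w\<close> vanishes at 0.\<close>
  define c where "c = (if even e then 0 else pw_inner m (pw_antideriv m g) (pw_one m))"
  define w where "w = pw_antideriv m g - pw_scale c (pw_one m)"
  have w0: "w j = 0" if "j \<ge> m" for j
    using that by (simp add: w_def pw_antideriv_zero pw_scale_def pw_one_def)
  have ws: "pw_smooth 1 m w"
    unfolding w_def by (intro pw_smooth_linear pw_antideriv_smooth pw_one_smooth)
  have dw: "pw_deriv w = g"
    using g0 by (simp add: w_def pw_deriv_linear pw_deriv_antideriv)
  \<comment> \<open>Constants lie in the space of parity \<open>Suc e\<close>, so \<open>g\<close>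
    is orthogonal to them and its antiderivative also vanishes at 1.\<close>
  have w_even: "poly (w 0) 0 = 0 \<and> poly (w (m - 1)) 1 = 0" if "even e"
  proof -
    have "poly (w 0) 0 = 0"
      using that m by (simp add: w_def c_def pw_antideriv_at_0 pw_scale_def)
    moreover have "pw_inner m g (pw_one m) = 0"
      unfolding g_def using that by (intro r(2) pw_one_sym) simp
    ultimately show ?thesis
      using pw_at_1[OF m ws] by (simp add: dw)
  qed
  have w_odd: "pw_inner m w (pw_one m) = 0" if "odd e"
    using that m by (simp add: w_def c_def pw_inner_simps pw_inner_one)
  \<comment> \<open>A second antiderivative of \<open>g\<close>. For odd \<open>e\<close> the
    mean-zero choice makes it vanish at both ends, as the induction hypothesis at parity
    \<open>Suc e\<close> demands.\<close>
  define Z where "Z = pw_antideriv m w"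
  have Z: "\<And>j. j \<ge> m \<Longrightarrow> Z j = 0" "pw_smooth 1 m Z" "pw_deriv Z = w" "poly (Z 0) 0 = 0"
    using w0 m by (auto simp: Z_def pw_antideriv_zero pw_antideriv_smooth[simplified] pw_deriv_antideriv pw_antideriv_at_0)
  have Z_odd: "poly (Z 0) 0 = 0 \<and> poly (Z (m - 1)) 1 = 0" if "odd e"
    using pw_at_1[OF m Z(2,4)] w_odd[OF that] Z(3,4) by simp
  obtain y where y: "y \<in> sym_pieces (Suc e) p m"
    "pw_inner m (Z - y) (Z - y) \<le> 4 / (real m)\<^sup>2 * pw_inner m w w"
  proof -
    have "\<exists>y\<in>sym_pieces (Suc e) p m. pw_inner m (Z - y) (Z - y) \<le> 4 / (real m)\<^sup>2 * pw_energy m Z Z \<and>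
        (0 < p \<longrightarrow> pw_energy m y y \<le> pw_energy m Z Z)"
      by (rule Suc.IH) (use Z(1,2) Z_odd in simp_all)
    then show ?thesis
      using that unfolding Z(3) by blast
  qed
  have bd: "poly (w 0) 0 * poly (Z 0) 0 = 0 \<and> poly (w (m - 1)) 1 * poly (Z (m - 1)) 1 = 0"
    using w_even Z_odd by (cases "even e") auto
  have "pw_inner m g Z + pw_inner m w w = 0"
    using pw_inner_by_parts[OF m _ _ ws Z(2)] bd by (simp add: dw Z(3))
  \<comment> \<open>The approximant \<open>y\<close> lies in the space onto which \<open>f\<close>
    was projected, hence is orthogonal to \<open>g\<close>.\<close>
  moreover have "pw_inner m g Z = pw_inner m g (Z - y)"
    using r(2)[OF y(1)] by (simp add: g_def pw_inner_simps)
  moreover define s where "s = 4 / (real m)\<^sup>2"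
  have s: "s > 0" using m by (simp add: s_def)
  have "2 * \<bar>pw_inner m g (Z - y)\<bar> \<le> s * pw_inner m g g + pw_inner m (Z - y) (Z - y) / s"
    using pw_inner_young[OF s] .
  moreover have "pw_inner m (Z - y) (Z - y) / s \<le> pw_inner m w w"
    using y(2) s by (simp add: s_def[symmetric] field_simps)
  ultimately have ww: "pw_inner m w w \<le> s * pw_inner m g g"
    by linarith
  have "pw_inner m g r = 0"
    unfolding g_def by (rule r(2)[OF r(1)])
  moreover have "f = g + r"
    by (simp add: g_def)
  ultimately have pyth: "pw_inner m f f = pw_inner m g g + pw_inner m r r"
    by (simp add: pw_inner_simps pw_inner_commute[of m r g])
  \<comment> \<open>Its error is \<open>w\<close> and its derivative is the best approximation
    \<open>r\<close>; Pythagoras for \<open>f = g + r\<close> controls both.\<close>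
  define v where "v = z - w"
  have dv: "pw_deriv v = r"
    by (simp add: v_def pw_deriv_linear dw f_def[symmetric] g_def)
  have "v \<in> sym_pieces e (Suc p) m"
  proof (rule sym_SucI)
    show "pw_smooth 1 m v"
      unfolding v_def by (intro pw_smooth_linear Suc.prems ws)
  qed (use Suc.prems w0 w_even dv r(1) in \<open>auto simp: v_def\<close>)
  moreover have "pw_inner m (z - v) (z - v) \<le> s * pw_inner m f f"
    using ww pyth s pw_inner_nonneg[of m r] by (simp add: v_def distrib_left add_increasing2)
  moreover have "pw_energy m v v \<le> pw_inner m f f"
    using pyth pw_inner_nonneg[of m g] by (simp add: dv)
  ultimately show ?case
    unfolding s_def f_def by blast
qed

text \<open>Compare the projection \<open>v\<close> with the approximant \<open>y\<close>. By
  Pythagoras \<open>v - y\<close> is no larger in L2 than \<open>u - y\<close>, so in the inverse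
  inequality the powers of \<open>m\<close> cancel and leave 48; adding \<open>y\<close> gives 98 =
  2 * 48 + 2.\<close>

lemma sym_proj_stable:
  assumes m: "m > 0" and p: "p > 0" and u: "u \<in> spline_pieces p m"
    and v: "v \<in> sym_pieces 1 p m" "\<And>w. w \<in> sym_pieces 1 p m \<Longrightarrow> pw_inner m (u - v) w = 0"
  shows "pw_energy m v v \<le> 98 * pw_energy m u u"
proof -
  obtain p' where p': "p = Suc p'"
    using p by (cases p) auto
  have "pw_smooth 1 m u"
    using spline_pieces_smooth[OF u] p by (auto intro: pw_smooth_mono)
  then obtain y where y: "y \<in> sym_pieces 1 p m"
    "pw_inner m (u - y) (u - y) \<le> 4 / (real m)\<^sup>2 * pw_energy m u u" "pw_energy m y y \<le> pw_energy m u u"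
    using sym_approximation[OF m, of u 1 p] spline_pieces_zero[OF u] p by auto
  have vy: "v - y \<in> sym_pieces 1 p m"
    using v(1) y(1) subspace_sym_pieces pieces.subspace_diff by blast
  have "u - y = (u - v) + (v - y)"
    by simp
  then have "pw_inner m (u - y) (u - y) = pw_inner m (u - v) (u - v) + pw_inner m (v - y) (v - y)"
    using v(2)[OF vy] pw_inner_commute[of m "u - v" "v - y"]
    by (simp only: pw_inner_add_left pw_inner_add_right)
  then have "pw_inner m (v - y) (v - y) \<le> 4 / (real m)\<^sup>2 * pw_energy m u u"
    using y(2) pw_inner_nonneg[of m "u - v"] by linarith
  then have "12 * (real m)\<^sup>2 * pw_inner m (v - y) (v - y) \<le> 48 * pw_energy m u u"
    using m by (simp add: field_simps)
  then have "pw_energy m (v - y) (v - y) \<le> 48 * pw_energy m u u"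
    using sym_inverse_inequality[OF m vy[unfolded p']] by linarith
  moreover have "pw_energy m v v \<le> 2 * pw_energy m (v - y) (v - y) + 2 * pw_energy m y y"
    using pw_inner_add_sq[of m "pw_deriv (v - y)" "pw_deriv y"] pw_deriv_linear(1)[of "v - y" y] by simp
  ultimately show ?thesis
    using y(3) by linarith
qed

section \<open>Splines as functions\<close>

text \<open>The floor selects pieces closed on the left, so an interior node takes the value of the
  piece to its right.\<close>

definition spline_fun :: "nat \<Rightarrow> (nat \<Rightarrow> real poly) \<Rightarrow> real \<Rightarrow> real" where
  "spline_fun m q t = (if t \<in> {0<..<1} then poly (q (nat \<lfloor>t * real m\<rfloor>)) t else 0)"

lemma spline_fun_outside: "t \<notin> {0<..<1} \<Longrightarrow> spline_fun m q t = 0"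
  by (simp only: spline_fun_def if_False)

lemma spline_fun_add: "spline_fun m (q + r) t = spline_fun m q t + spline_fun m r t"
  and spline_fun_diff: "spline_fun m (q - r) t = spline_fun m q t - spline_fun m r t"
  and spline_fun_scale: "spline_fun m (pw_scale c q) t = c * spline_fun m q t"
  by (simp_all add: spline_fun_def pw_scale_def)

lemma spline_fun_mult: "spline_fun m q t * spline_fun m r t = spline_fun m (\<lambda>j. q j * r j) t"
  by (simp add: spline_fun_def)

lemma spline_fun_zero: "spline_fun m 0 t = 0"
  by (simp add: spline_fun_def)

lemma spline_fun_piece:
  assumes "j < m" "node m j \<le> t" "t < node m (Suc j)" "0 < t"
  shows "t \<in> {0<..<1}" "spline_fun m q t = poly (q j) t"
proof -
  have m: "real m > 0" using assms(1) by simp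
  have "node m (Suc j) \<le> 1"
    using assms(1) by (simp add: node_def)
  then show t: "t \<in> {0<..<1}"
    using assms by simp
  have "\<lfloor>t * real m\<rfloor> = int j"
    using assms m by (intro floor_unique) (auto simp: node_def field_simps)
  then show "spline_fun m q t = poly (q j) t"
    using t by (simp add: spline_fun_def)
qed

lemma node_cases:
  assumes "m > 0" "t \<in> {0<..<1}"
  obtains j where "j < m" "node m j \<le> t" "t < node m (Suc j)"
proof
  have m: "real m > 0" using assms(1) by simp
  define j where "j = nat \<lfloor>t * real m\<rfloor>"
  have "t * real m \<ge> 0" "t * real m < real m"
    using assms by auto
  then have j: "real j \<le> t * real m" "t * real m < real j + 1"
    unfolding j_def by linarith+
  show "node m j \<le> t" "t < node m (Suc j)"
    using j m by (auto simp: node_def field_simps)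
  show "j < m"
    using j \<open>t * real m < real m\<close> by linarith
qed

lemma node_in_unit: "0 < j \<Longrightarrow> j < m \<Longrightarrow> node m j \<in> {0<..<1}"
  by (simp add: node_def)

lemma node_nonneg [simp]: "0 \<le> node m j"
  by (simp add: node_def)

lemma piece_open_subset: "j < m \<Longrightarrow> node m j < t \<Longrightarrow> t < node m (Suc j) \<Longrightarrow> t \<in> {0<..<1}"
  using spline_fun_piece(1)[of j m t] node_nonneg[of m j] by linarith

lemma spline_fun_at_right:
  assumes "j < m" "node m j \<le> t" "t < node m (Suc j)"
  shows "eventually (\<lambda>s. spline_fun m q s = poly (q j) s) (at_right t)"
  using eventually_at_right_real[OF assms(3)]
proof eventually_elim
  case (elim s)
  then show ?case
    using assms by (intro spline_fun_piece(2)) (auto intro: le_less_trans[OF order_trans[OF node_nonneg]])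
qed

lemma spline_fun_at_left:
  assumes "j < m" "node m j < t" "t \<le> node m (Suc j)"
  shows "eventually (\<lambda>s. spline_fun m q s = poly (q j) s) (at_left t)"
  using eventually_at_left_real[OF assms(2)]
proof eventually_elim
  case (elim s)
  then show ?case
    using assms by (intro spline_fun_piece(2)) (auto intro: le_less_trans[OF node_nonneg])
qed

text \<open>Piece \<open>j\<close> describes the function to the left of \<open>t\<close>, piece
  \<open>k\<close> at \<open>t\<close> and to its right. Quantifying over \<open>q\<close> inside
  lets the same indices serve a spline and its derivative.\<close>

lemma local_pieces:
  assumes "m > 0" "t \<in> {0<..<1}"
  obtains j k where "j < m" "k < m" "k = j \<or> k = Suc j \<and> t = node m (Suc j)"
    "\<forall>q. eventually (\<lambda>s. spline_fun m q s = poly (q j) s) (at_left t)"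
    "\<forall>q. eventually (\<lambda>s. spline_fun m q s = poly (q k) s) (at_right t)"
    "\<forall>q. spline_fun m q t = poly (q k) t"
proof -
  obtain k where k: "k < m" "node m k \<le> t" "t < node m (Suc k)"
    using node_cases[OF assms] .
  note right = spline_fun_at_right[OF k] spline_fun_piece(2)[OF k]
  show ?thesis
  proof (cases "node m k = t")
    case True
    then obtain j where j: "k = Suc j"
      using assms(2) by (cases k) auto
    have "node m j < t" "t \<le> node m (Suc j)"
      using True j assms(1) by auto
    then show ?thesis
      using that[of j k] j k True right spline_fun_at_left[of j m t] assms(2) by auto
  next
    case False
    then show ?thesis
      using that[of k k] k right spline_fun_at_left[of k m t] assms(2) by auto
  qed
qed

section \<open>Continuity, derivatives and one-sided limits\<close>

lemma poly_tendsto: "(poly (q :: real poly) \<longlongrightarrow> poly q t) (at t within S)"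
  using poly_isCont[of t q] by (auto simp: isCont_def intro: tendsto_mono[OF at_le])

lemma spline_fun_isCont:
  assumes "m > 0" "t \<in> {0<..<1}" "pw_smooth 1 m q"
  shows "isCont (spline_fun m q) t"
proof -
  obtain j k where jk: "j < m" "k < m" "k = j \<or> k = Suc j \<and> t = node m (Suc j)"
    and lr: "\<forall>q. eventually (\<lambda>s. spline_fun m q s = poly (q j) s) (at_left t)"
      "\<forall>q. eventually (\<lambda>s. spline_fun m q s = poly (q k) s) (at_right t)"
    and tk: "\<forall>q. spline_fun m q t = poly (q k) t"
    using local_pieces[OF assms(1,2)] by blast
  note l = lr(1)[rule_format, of q] and r = lr(2)[rule_format, of q] and t = tk[rule_format]
  have "poly (q j) t = poly (q k) t"
    using jk assms(3) by (auto simp: pw_smooth_def)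
  then show ?thesis
    unfolding isCont_def t
    by (intro filterlim_split_at) (use tendsto_cong[OF l] tendsto_cong[OF r] poly_tendsto in metis)+
qed

text \<open>Smoothness of order 2 matches values and first derivatives, so both one-sided difference
  quotients have the same limit.\<close>

lemma spline_fun_deriv:
  assumes "m > 0" "t \<in> {0<..<1}" "pw_smooth 2 m q"
  shows "(spline_fun m q has_real_derivative spline_fun m (pw_deriv q) t) (at t)"
proof -
  obtain j k where jk: "j < m" "k < m" "k = j \<or> k = Suc j \<and> t = node m (Suc j)"
    and lr: "\<forall>q. eventually (\<lambda>s. spline_fun m q s = poly (q j) s) (at_left t)"
      "\<forall>q. eventually (\<lambda>s. spline_fun m q s = poly (q k) s) (at_right t)"
    and tk: "\<forall>q. spline_fun m q t = poly (q k) t"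
    using local_pieces[OF assms(1,2)] by blast
  note l = lr(1)[rule_format, of q] and r = lr(2)[rule_format, of q] and t = tk[rule_format]
  have eq: "poly (q j) t = poly (q k) t" "poly (pderiv (q j)) t = poly (pderiv (q k)) t"
    using jk assms(3)[unfolded pw_smooth_def, rule_format, of j 0]
      assms(3)[unfolded pw_smooth_def, rule_format, of j 1] by auto
  have D: "((\<lambda>s. (poly (q i) s - poly (q i) t) / (s - t)) \<longlongrightarrow> poly (pderiv (q i)) t) (at t within S)" for i S
    using has_field_derivative_at_within[OF poly_DERIV[of "q i" t]] by (simp add: has_field_derivative_iff)
  show ?thesis
    unfolding has_field_derivative_iff t
  proof (intro filterlim_split_at)
    show "((\<lambda>y. (spline_fun m q y - poly (q k) t) / (y - t)) \<longlongrightarrow> poly (pw_deriv q k) t) (at_left t)"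
      using D[of j "{..<t}"] unfolding eq pw_deriv_def
      by (rule Lim_transform_eventually) (use l in eventually_elim, simp)
    show "((\<lambda>y. (spline_fun m q y - poly (q k) t) / (y - t)) \<longlongrightarrow> poly (pw_deriv q k) t) (at_right t)"
      using D[of k "{t<..}"] unfolding pw_deriv_def
      by (rule Lim_transform_eventually) (use r in eventually_elim, simp)
  qed
qed

lemma pw_deriv_funpow: "(pw_deriv ^^ i) q j = (pderiv ^^ i) (q j)"
  by (induction i) (auto simp: pw_deriv_def)

lemma pw_smooth_funpow: "pw_smooth n m q \<Longrightarrow> i + k \<le> n \<Longrightarrow> pw_smooth k m ((pw_deriv ^^ i) q)"
proof -
  have "(pderiv ^^ a) ((pderiv ^^ b) r) = (pderiv ^^ (a + b)) r" for a b and r :: "real poly"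
    by (simp add: funpow_add)
  then show "pw_smooth n m q \<Longrightarrow> i + k \<le> n \<Longrightarrow> pw_smooth k m ((pw_deriv ^^ i) q)"
    by (simp add: pw_smooth_def pw_deriv_funpow)
qed

text \<open>Each differentiation uses up one order of smoothness and needs two orders to be
  available; hence the range \<open>i < n\<close>.\<close>

lemma higher_deriv_spline_fun:
  assumes "m > 0" "pw_smooth n m q" "i < n" "t \<in> {0<..<1}"
  shows "(deriv ^^ i) (spline_fun m q) t = spline_fun m ((pw_deriv ^^ i) q) t"
  using assms(3,4)
proof (induction i arbitrary: t)
  case (Suc i)
  have "eventually (\<lambda>s. s \<in> {0<..<1}) (nhds t)"
    using Suc.prems by (intro eventually_nhds_in_open) auto
  then have "eventually (\<lambda>s. (deriv ^^ i) (spline_fun m q) s = spline_fun m ((pw_deriv ^^ i) q) s) (nhds t)"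
    by (rule eventually_mono) (intro Suc.IH Suc_lessD[OF Suc.prems(1)])
  then have "(deriv ^^ Suc i) (spline_fun m q) t = deriv (spline_fun m ((pw_deriv ^^ i) q)) t"
    by (auto intro: deriv_cong_ev)
  also have "\<dots> = spline_fun m ((pw_deriv ^^ Suc i) q) t"
    using DERIV_imp_deriv[OF spline_fun_deriv[OF assms(1) Suc.prems(2) pw_smooth_funpow[OF assms(2), of i]]]
      Suc.prems(1) by simp
  finally show ?case .
qed simp

lemma higher_deriv_poly_on_open:
  fixes u :: "real \<Rightarrow> real"
  assumes "\<And>s. s \<in> {a<..<b} \<Longrightarrow> u s = poly q s" "t \<in> {a<..<b}"
  shows "(deriv ^^ i) u t = poly ((pderiv ^^ i) q) t"
  using assms(2)
proof (induction i arbitrary: t)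
  case (Suc i)
  have "eventually (\<lambda>s. s \<in> {a<..<b}) (nhds t)"
    using Suc.prems by (intro eventually_nhds_in_open) auto
  then have "eventually (\<lambda>s. (deriv ^^ i) u s = poly ((pderiv ^^ i) q) s) (nhds t)"
    by (rule eventually_mono) (rule Suc.IH)
  then have "(deriv ^^ Suc i) u t = deriv (poly ((pderiv ^^ i) q)) t"
    by (auto intro: deriv_cong_ev)
  also have "\<dots> = poly ((pderiv ^^ Suc i) q) t"
    by (auto intro: DERIV_imp_deriv poly_DERIV)
  finally show ?case .
qed (use assms in auto)

lemma higher_deriv_at_right:
  fixes q :: "real poly"
  assumes "\<And>s. s \<in> {a<..<b} \<Longrightarrow> u s = poly q s" "a < b"
  shows "((deriv ^^ i) u \<longlongrightarrow> poly ((pderiv ^^ i) q) a) (at_right a)"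
  using poly_tendsto[of "(pderiv ^^ i) q" a "{a<..}"]
proof (rule Lim_transform_eventually)
  show "\<forall>\<^sub>F s in at_right a. poly ((pderiv ^^ i) q) s = (deriv ^^ i) u s"
    using eventually_at_right_real[OF assms(2)]
    by eventually_elim (rule higher_deriv_poly_on_open[OF assms(1), symmetric])
qed

lemma higher_deriv_at_left:
  fixes q :: "real poly"
  assumes "\<And>s. s \<in> {a<..<b} \<Longrightarrow> u s = poly q s" "a < b"
  shows "((deriv ^^ i) u \<longlongrightarrow> poly ((pderiv ^^ i) q) b) (at_left b)"
  using poly_tendsto[of "(pderiv ^^ i) q" b "{..<b}"]
proof (rule Lim_transform_eventually)
  show "\<forall>\<^sub>F s in at_left b. poly ((pderiv ^^ i) q) s = (deriv ^^ i) u s"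
    using eventually_at_left_real[OF assms(2)]
    by eventually_elim (rule higher_deriv_poly_on_open[OF assms(1), symmetric])
qed

text \<open>Derivatives of order below \<open>p - 1\<close> retain two orders of smoothness and are
  differentiable; order \<open>p - 1\<close> retains one and is continuous.\<close>

lemma spline_fun_splines:
  assumes m: "m > 0" and p: "p > 0" and q: "q \<in> spline_pieces p m"
  shows "spline_fun m q \<in> splines p m"
proof -
  have s: "pw_smooth p m q"
    using q by (rule spline_pieces_smooth)
  have "(deriv ^^ j) (spline_fun m q) differentiable_on {0<..<1}" if "j < p - 1" for j
    unfolding differentiable_on_def
  proof
    fix t :: real assume t: "t \<in> {0<..<1}"
    have "spline_fun m ((pw_deriv ^^ j) q) differentiable (at t within {0<..<1})"
    proof -
      have "pw_smooth 2 m ((pw_deriv ^^ j) q)"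
        using that by (intro pw_smooth_funpow[OF s]) simp
      from has_field_derivative_at_within[OF spline_fun_deriv[OF m t this]] show ?thesis
        unfolding real_differentiable_def by blast
    qed
    then show "(deriv ^^ j) (spline_fun m q) differentiable (at t within {0<..<1})"
      using t higher_deriv_spline_fun[OF m s, of j] that
      by (elim differentiable_transform_within[of _ _ _ 1]) auto
  qed
  moreover have "continuous_on {0<..<1} ((deriv ^^ (p - 1)) (spline_fun m q))"
  proof -
    have "continuous_on {0<..<1} (spline_fun m ((pw_deriv ^^ (p - 1)) q))"
      using spline_fun_isCont[OF m _ pw_smooth_funpow[OF s]] p
      by (intro continuous_at_imp_continuous_on) auto
    then show ?thesis
      using higher_deriv_spline_fun[OF m s, of "p - 1"] p by (subst continuous_on_cong) auto
  qed
  moreover have "\<exists>r :: real poly. degree r \<le> p \<and>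
      (\<forall>t\<in>{(real j - 1) / real m <..< real j / real m}. spline_fun m q t = poly r t)" if j: "j \<in> {1..m}" for j
  \<comment> \<open>Intervals are counted from 1 in \<open>splines\<close>, pieces from 0.\<close>
  proof (intro exI[of _ "q (j - 1)"] conjI ballI)
    show "degree (q (j - 1)) \<le> p"
    proof -
      have "j - 1 < m"
        using j by auto
      then show ?thesis
        using q by (simp add: spline_pieces_def)
    qed
    fix t assume t: "t \<in> {(real j - 1) / real m <..< real j / real m}"
    have "node m (j - 1) < t" "t < node m (Suc (j - 1))"
      using t j by (auto simp: node_def of_nat_diff)
    then show "spline_fun m q t = poly (q (j - 1)) t"
      using j by (intro spline_fun_piece(2)) (auto intro: le_less_trans[OF node_nonneg])
  qed
  ultimately show ?thesis
    by (auto simp: splines_def C_on_def spline_fun_outside)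
qed

lemma spline_fun_open_piece:
  assumes "j < m" "s \<in> {node m j<..<node m (Suc j)}"
  shows "spline_fun m q s = poly (q j) s"
  using assms by (intro spline_fun_piece(2)) (auto intro: le_less_trans[OF node_nonneg])

lemma spline_fun_at_ends:
  assumes "m > 0"
  shows "((deriv ^^ i) (spline_fun m q) \<longlongrightarrow> poly ((pderiv ^^ i) (q 0)) 0) (at_right 0)"
    "((deriv ^^ i) (spline_fun m q) \<longlongrightarrow> poly ((pderiv ^^ i) (q (m - 1))) 1) (at_left 1)"
proof -
  have "node m (m - 1) < node m (Suc (m - 1))" "node m 0 < node m (Suc 0)"
    by (rule node_simps(3)[OF assms])+
  then show "((deriv ^^ i) (spline_fun m q) \<longlongrightarrow> poly ((pderiv ^^ i) (q 0)) 0) (at_right 0)"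
    "((deriv ^^ i) (spline_fun m q) \<longlongrightarrow> poly ((pderiv ^^ i) (q (m - 1))) 1) (at_left 1)"
    using higher_deriv_at_right[of "node m 0" "node m (Suc 0)" "spline_fun m q" "q 0" i]
      higher_deriv_at_left[of "node m (m - 1)" "node m (Suc (m - 1))" "spline_fun m q" "q (m - 1)" i]
      spline_fun_open_piece[of 0 m _ q] spline_fun_open_piece[of "m - 1" m _ q] assms
    by simp_all
qed

lemma spline_fun_splines0_iff:
  assumes m: "m > 0" and p: "p > 0" and q: "q \<in> spline_pieces p m"
  shows "spline_fun m q \<in> splines0 p m \<longleftrightarrow> q \<in> sym_pieces 1 p m"
proof -
  note e = spline_fun_at_ends[OF m, of _ q]
  have L: "(f \<longlongrightarrow> 0) F \<longleftrightarrow> c = 0" if "(f \<longlongrightarrow> c) F" "F \<noteq> bot" for f :: "real \<Rightarrow> real" and c F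
    by (metis tendsto_unique that)
  have lim: "((deriv ^^ i) (spline_fun m q) \<longlongrightarrow> 0) (at_right 0) \<longleftrightarrow> poly ((pderiv ^^ i) (q 0)) 0 = 0"
    "((deriv ^^ i) (spline_fun m q) \<longlongrightarrow> 0) (at_left 1) \<longleftrightarrow> poly ((pderiv ^^ i) (q (m - 1))) 1 = 0" for i
    using L[OF e(1)] L[OF e(2)] trivial_limit_at_right_real trivial_limit_at_left_real by blast+
  have "(\<forall>i<p. even (i + 1) \<longrightarrow> P i) \<longleftrightarrow> (\<forall>l. 2 * l + 1 < p \<longrightarrow> P (2 * l + 1))" for P
    by (auto elim!: oddE)
  then show ?thesis
    using spline_fun_splines[OF assms] q
    unfolding splines0_def sym_pieces_def mem_Collect_eq lim by simp
qed

text \<open>Up to order \<open>p - 1\<close> the derivatives are continuous at a node, so their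
  one-sided limits, given by the two adjacent polynomials, agree there.\<close>

lemma splines_imp_spline_fun:
  assumes m: "m > 0" and p: "p > 0" and u: "u \<in> splines p m"
  obtains q where "q \<in> spline_pieces p m" "u = spline_fun m q"
proof -
  have "\<exists>r :: real poly. degree r \<le> p \<and> (\<forall>t\<in>{node m j<..<node m (Suc j)}. u t = poly r t)" if "j < m" for j
    using u that unfolding splines_def by (auto dest!: bspec[of _ _ "Suc j"] simp: node_def)
  then obtain r where r: "\<And>j. j < m \<Longrightarrow> degree (r j) \<le> p"
    "\<And>j t. j < m \<Longrightarrow> t \<in> {node m j<..<node m (Suc j)} \<Longrightarrow> u t = poly (r j) t"
    by metis
  define q where "q j = (if j < m then r j else 0)" for j
  have q: "\<And>j t. j < m \<Longrightarrow> t \<in> {node m j<..<node m (Suc j)} \<Longrightarrow> u t = poly (q j) t"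
    using r by (simp add: q_def)
  have cont: "isCont ((deriv ^^ i) u) t" if "i < p" "t \<in> {0<..<1}" for i t
  proof -
    have "continuous_on {0<..<1} ((deriv ^^ i) u)"
      using u that(1) by (cases "i = p - 1")
        (auto simp: splines_def C_on_def intro: differentiable_imp_continuous_on)
    then show ?thesis
      using that(2) by (simp add: continuous_on_eq_continuous_at)
  qed
  have match: "poly ((pderiv ^^ i) (q j)) t = (deriv ^^ i) u t" "poly ((pderiv ^^ i) (q (Suc j))) t = (deriv ^^ i) u t"
    if "Suc j < m" "i < p" "t = node m (Suc j)" for i j t
  proof -
    have "isCont ((deriv ^^ i) u) t"
      using cont that node_in_unit[of "Suc j" m] by simp
    then have "((deriv ^^ i) u \<longlongrightarrow> (deriv ^^ i) u t) (at_left t)" "((deriv ^^ i) u \<longlongrightarrow> (deriv ^^ i) u t) (at_right t)"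
      by (simp_all add: isCont_def filterlim_at_split)
    moreover have "((deriv ^^ i) u \<longlongrightarrow> poly ((pderiv ^^ i) (q j)) t) (at_left t)"
      using higher_deriv_at_left[of "node m j" "node m (Suc j)" u "q j" i] q[of j] that m by simp
    moreover have "((deriv ^^ i) u \<longlongrightarrow> poly ((pderiv ^^ i) (q (Suc j))) t) (at_right t)"
      using higher_deriv_at_right[of "node m (Suc j)" "node m (Suc (Suc j))" u "q (Suc j)" i] q[of "Suc j"] that m by simp
    ultimately show "poly ((pderiv ^^ i) (q j)) t = (deriv ^^ i) u t"
      "poly ((pderiv ^^ i) (q (Suc j))) t = (deriv ^^ i) u t"
      using tendsto_unique[OF trivial_limit_at_left_real] tendsto_unique[OF trivial_limit_at_right_real] by blast+
  qed
  show ?thesis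
  proof
    show "q \<in> spline_pieces p m"
      using match r(1) by (auto simp: spline_pieces_def pw_smooth_def q_def)
    show "u = spline_fun m q"
    proof
      fix t
      show "u t = spline_fun m q t"
      proof (cases "t \<in> {0<..<1}")
        case True
        then obtain j where j: "j < m" "node m j \<le> t" "t < node m (Suc j)"
          using node_cases[OF m] by blast
        \<comment> \<open>The pieces are given on open intervals only; at a node the order zero case
          of \<open>match\<close> supplies the value.\<close>
        have "u t = poly (q j) t"
        proof (cases "node m j = t")
          case eq: True
          then obtain k where "j = Suc k"
            using True by (cases j) auto
          then show ?thesis
            using match(2)[of k 0 t] eq j p by simp
        qed (use q j in auto)
        then show ?thesis
          using spline_fun_piece(2)[OF j] True by simp
      next
        case False
        then show ?thesis
          using u by (simp add: splines_def spline_fun_outside)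
      qed
    qed
  qed
qed

lemma splines_eq:
  assumes "m > 0" "p > 0"
  shows "splines p m = spline_fun m ` spline_pieces p m"
  using splines_imp_spline_fun[OF assms] spline_fun_splines[OF assms] by blast

lemma splines0_eq:
  assumes "m > 0" "p > 0"
  shows "splines0 p m = spline_fun m ` sym_pieces 1 p m"
proof -
  have "splines0 p m \<subseteq> splines p m"
    unfolding splines0_def by blast
  then show ?thesis
    using spline_fun_splines0_iff[OF assms] sym_pieces_subset[of _ 1 p m]
    unfolding splines_eq[OF assms] by blast
qed

section \<open>Integrals of splines over the unit interval\<close>

lemma spline_fun_eq_sum:
  assumes "m > 0"
  shows "spline_fun m q t = (\<Sum>j<m. indicator ({node m j..<node m (Suc j)} \<inter> {0<..<1}) t * poly (q j) t)"
proof (cases "t \<in> {0<..<1}")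
  case True
  then obtain k where k: "k < m" "node m k \<le> t" "t < node m (Suc k)"
    using node_cases[OF assms] by blast
  have "t \<in> {node m j..<node m (Suc j)} \<longleftrightarrow> j = k" for j
  proof
    assume "t \<in> {node m j..<node m (Suc j)}"
    then have "node m j < node m (Suc k)" "node m k < node m (Suc j)"
      using k by auto
    then show "j = k"
      using assms by (simp add: node_def divide_less_cancel)
  qed (use k in auto)
  then have "(\<Sum>j<m. indicator ({node m j..<node m (Suc j)} \<inter> {0<..<1}) t * poly (q j) t)
      = (\<Sum>j<m. if j = k then poly (q k) t else 0)"
    using True by (intro sum.cong) (auto simp: indicator_def)
  also have "\<dots> = spline_fun m q t"
    using k spline_fun_piece(2)[OF k] True by simp
  finally show ?thesis ..
qed (auto simp: spline_fun_outside)

lemma spline_fun_eq_sum':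
  "m > 0 \<Longrightarrow> spline_fun m q = (\<lambda>t. \<Sum>j<m. indicator ({node m j..<node m (Suc j)} \<inter> {0<..<1}) t * poly (q j) t)"
  using spline_fun_eq_sum by blast

text \<open>A finite sum of integrals over single pieces. The half-open intervals cut to (0,1)
  differ from the closed ones only in end points, a null set.\<close>

lemma spline_fun_has_bochner_integral:
  assumes "m > 0"
  shows "has_bochner_integral lborel (spline_fun m q)
    (\<Sum>j<m. integral {node m j..node m (Suc j)} (poly (q j)))"
proof -
  have [measurable]: "poly r \<in> borel_measurable borel" for r :: "real poly"
    by (intro borel_measurable_continuous_onI continuous_intros)
  have "has_bochner_integral lborel
      (\<lambda>t. indicator ({node m j..<node m (Suc j)} \<inter> {0<..<1}) t * poly (q j) t)
      (integral {node m j..node m (Suc j)} (poly (q j)))" if j: "j < m" for j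
  proof -
    let ?I = "{node m j..node m (Suc j)}"
    have I: "set_integrable lborel ?I (poly (q j))"
      by (intro borel_integrable_atLeastAtMost' continuous_intros)
    have "has_bochner_integral lborel (\<lambda>t. indicator ?I t *\<^sub>R poly (q j) t) (integral ?I (poly (q j)))"
      using I set_borel_integral_eq_integral(2)[OF I]
      by (simp add: has_bochner_integral_iff set_integrable_def set_lebesgue_integral_def)
    moreover have "AE t in lborel. indicator ?I t *\<^sub>R poly (q j) t =
        indicator ({node m j..<node m (Suc j)} \<inter> {0<..<1}) t * poly (q j) t"
      using AE_lborel_singleton[of "node m j"] AE_lborel_singleton[of "node m (Suc j)"]
    proof eventually_elim
      case (elim t)
      then show ?case
        using piece_open_subset[OF j, of t] by (auto simp: indicator_def)
    qed
    ultimately show ?thesis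
      by (subst (asm) has_bochner_integral_cong_AE[where g = "\<lambda>t. indicator ({node m j..<node m (Suc j)} \<inter> {0<..<1}) t * poly (q j) t"]) auto
  qed
  then show ?thesis
    unfolding spline_fun_eq_sum'[OF assms] by (intro has_bochner_integral_sum) auto
qed

lemma spline_fun_inner:
  assumes "m > 0"
  shows "has_bochner_integral lborel (\<lambda>t. spline_fun m q t * spline_fun m r t) (pw_inner m q r)"
  unfolding spline_fun_mult pw_inner_def by (rule spline_fun_has_bochner_integral[OF assms])

lemma L2_inner_spline_fun:
  assumes "m > 0"
  shows "L2_inner (spline_fun m q) (spline_fun m r) = pw_inner m q r"
proof -
  have "L2_inner (spline_fun m q) (spline_fun m r)
      = integral\<^sup>L lebesgue (\<lambda>t. spline_fun m q t * spline_fun m r t)"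
    unfolding L2_inner_def set_lebesgue_integral_def
  proof (intro Bochner_Integration.integral_cong refl)
    show "indicator {0<..<1} t *\<^sub>R (spline_fun m q t * spline_fun m r t) = spline_fun m q t * spline_fun m r t" for t
      by (cases "t \<in> {0<..<1}") (simp_all add: spline_fun_outside del: greaterThanLessThan_iff)
  qed
  also have "\<dots> = pw_inner m q r"
    using spline_fun_inner[OF assms, of q r]
    by (subst integral_completion) (auto simp: has_bochner_integral_iff)
  finally show ?thesis .
qed

section \<open>Tensor products\<close>

lemma pw_inner_sum_left: "pw_inner m (\<Sum>k\<in>A. F k) s = (\<Sum>k\<in>A. pw_inner m (F k) s)"
  by (induction A rule: infinite_finite_induct) (simp_all only: sum.infinite sum.empty sum.insert not_False_eq_True pw_inner_zero pw_inner_add_left)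

lemma pw_inner_sum_right: "pw_inner m s (\<Sum>k\<in>A. F k) = (\<Sum>k\<in>A. pw_inner m s (F k))"
  by (simp only: pw_inner_commute[of m s] pw_inner_sum_left)

text \<open>The quadratic form of a Gram matrix. It turns an inequality for all linear combinations
  into positive semidefiniteness of a kernel.\<close>

lemma pw_inner_combination:
  "pw_inner m (\<Sum>k\<in>A. pw_scale (c k) (F k)) (\<Sum>k\<in>A. pw_scale (c k) (F k))
    = (\<Sum>k\<in>A. \<Sum>l\<in>A. c k * c l * pw_inner m (F k) (F l))"
  unfolding pw_inner_sum_left unfolding pw_inner_sum_right
  by (simp only: pw_inner_scale_left pw_inner_scale_right mult.assoc mult.left_commute)

lemma pw_deriv_combination:
  "pw_deriv (\<Sum>k\<in>A. pw_scale (c k) (F k)) = (\<Sum>k\<in>A. pw_scale (c k) (pw_deriv (F k)))"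
  by (induction A rule: infinite_finite_induct)
    (simp_all only: sum.infinite sum.empty sum.insert not_False_eq_True pw_deriv_linear)

lemma spline_fun_combination:
  "spline_fun m (\<Sum>k\<in>A. pw_scale (c k) (F k)) t = (\<Sum>k\<in>A. c k * spline_fun m (F k) t)"
  by (induction A rule: infinite_finite_induct)
    (simp_all only: sum.infinite sum.empty sum.insert not_False_eq_True spline_fun_zero spline_fun_add spline_fun_scale)

section \<open>The one-dimensional projector on families of pieces\<close>

definition pw_proj :: "nat \<Rightarrow> nat \<Rightarrow> (nat \<Rightarrow> real poly) \<Rightarrow> nat \<Rightarrow> real poly" where
  "pw_proj p m q = (SOME v. v \<in> sym_pieces 1 p m \<and> (\<forall>w\<in>sym_pieces 1 p m. pw_inner m (q - v) w = 0))"

definition pw_component :: "nat \<Rightarrow> nat \<Rightarrow> nat \<Rightarrow> (nat \<Rightarrow> real poly) \<Rightarrow> nat \<Rightarrow> real poly" where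
  "pw_component p m a q = (if a = 0 then pw_proj p m q else q - pw_proj p m q)"

lemma pw_proj_sym: "pw_proj p m q \<in> sym_pieces 1 p m"
  and pw_proj_orthogonal: "w \<in> sym_pieces 1 p m \<Longrightarrow> pw_inner m (q - pw_proj p m q) w = 0"
proof -
  have "\<exists>v. v \<in> sym_pieces 1 p m \<and> (\<forall>w\<in>sym_pieces 1 p m. pw_inner m (q - v) w = 0)"
    using orthogonal_proj_sym by blast
  from someI_ex[OF this] show "pw_proj p m q \<in> sym_pieces 1 p m"
    "w \<in> sym_pieces 1 p m \<Longrightarrow> pw_inner m (q - pw_proj p m q) w = 0"
    unfolding pw_proj_def by blast+
qed

text \<open>Two candidates differ by an element of the space that is orthogonal to itself; pieces
  from \<open>m\<close> on vanish by convention, so the families agree everywhere.\<close>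

lemma pw_proj_unique:
  assumes v: "v \<in> sym_pieces 1 p m" "\<And>w. w \<in> sym_pieces 1 p m \<Longrightarrow> pw_inner m (q - v) w = 0"
  shows "pw_proj p m q = v"
proof
  fix j
  let ?d = "pw_proj p m q - v"
  have d: "?d \<in> sym_pieces 1 p m"
    by (intro pieces.subspace_diff[OF subspace_sym_pieces] pw_proj_sym v(1))
  have "?d = (q - v) - (q - pw_proj p m q)"
    by simp
  then have "pw_inner m ?d ?d = 0"
    using v(2)[OF d] pw_proj_orthogonal[OF d, of q] pw_inner_diff_left[of m "q - v" "q - pw_proj p m q" ?d] by simp
  then have "?d j = 0"
    using pw_inner_eq_0[of m ?d j] spline_pieces_zero[OF sym_pieces_subset[OF d], of j] by (cases "j < m") auto
  then show "pw_proj p m q j = v j"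
    by simp
qed

lemma pw_proj_add: "pw_proj p m (q + r) = pw_proj p m q + pw_proj p m r"
proof (rule pw_proj_unique)
  show "pw_proj p m q + pw_proj p m r \<in> sym_pieces 1 p m"
    by (intro pieces.subspace_add[OF subspace_sym_pieces] pw_proj_sym)
  fix w assume "w \<in> sym_pieces 1 p m"
  from pw_proj_orthogonal[OF this, of q] pw_proj_orthogonal[OF this, of r]
  show "pw_inner m (q + r - (pw_proj p m q + pw_proj p m r)) w = 0"
    by (simp add: pw_inner_simps)
qed

lemma pw_proj_scale: "pw_proj p m (pw_scale c q) = pw_scale c (pw_proj p m q)"
proof (rule pw_proj_unique)
  show "pw_scale c (pw_proj p m q) \<in> sym_pieces 1 p m"
    by (intro pieces.subspace_scale[OF subspace_sym_pieces] pw_proj_sym)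
  fix w assume "w \<in> sym_pieces 1 p m"
  from pw_proj_orthogonal[OF this, of q]
  show "pw_inner m (pw_scale c q - pw_scale c (pw_proj p m q)) w = 0"
    by (simp add: pw_inner_simps)
qed

lemma pw_proj_0: "pw_proj p m 0 = 0"
  by (rule pw_proj_unique) (simp_all only: pieces.subspace_0[OF subspace_sym_pieces] pw_inner_zero diff_self)

lemma pw_component_combination:
  "pw_component p m a (\<Sum>k\<in>A. pw_scale (c k) (F k)) = (\<Sum>k\<in>A. pw_scale (c k) (pw_component p m a (F k)))"
proof -
  have proj: "pw_proj p m (\<Sum>k\<in>A. pw_scale (c k) (F k)) = (\<Sum>k\<in>A. pw_scale (c k) (pw_proj p m (F k)))"
    by (induction A rule: infinite_finite_induct)
      (simp_all only: sum.infinite sum.empty sum.insert not_False_eq_True pw_proj_0 pw_proj_add pw_proj_scale)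
  show ?thesis
  proof (cases "a = 0")
    case False
    then show ?thesis
      by (simp only: pw_component_def if_False proj pieces.scale_right_diff_distrib sum_subtractf)
  qed (simp only: pw_component_def simp_thms if_True proj)
qed

text \<open>Pythagoras in bilinear form: the mixed terms vanish since residuals are orthogonal to
  projections. Gram matrices require the version for pairs.\<close>

lemma pw_component_inner_sum:
  "(\<Sum>a\<in>{0, 1}. pw_inner m (pw_component p m a q) (pw_component p m a r)) = pw_inner m q r"
proof -
  have "pw_inner m (q - pw_proj p m q) (pw_proj p m r) = 0" "pw_inner m (r - pw_proj p m r) (pw_proj p m q) = 0"
    by (intro pw_proj_orthogonal pw_proj_sym)+
  then show ?thesis
    by (simp add: pw_component_def pw_inner_diff_left pw_inner_diff_right)
      (simp add: pw_inner_commute)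
qed

text \<open>The projection contributes 98 and its complement 2 + 2 * 98, in total 296.\<close>

lemma pw_component_energy_le:
  assumes "m > 0" "p > 0" "q \<in> spline_pieces p m"
  shows "(\<Sum>a\<in>{0, 1}. pw_energy m (pw_component p m a q) (pw_component p m a q)) \<le> 296 * pw_energy m q q"
proof -
  define v where "v = pw_proj p m q"
  have 1: "pw_energy m v v \<le> 98 * pw_energy m q q"
    unfolding v_def by (rule sym_proj_stable[OF assms pw_proj_sym pw_proj_orthogonal])
  have "pw_energy m (q - v) (q - v) \<le> 2 * pw_energy m q q + 2 * pw_energy m v v"
    unfolding pw_deriv_linear(2) using pw_inner_nonneg[of m "pw_deriv q + pw_deriv v"]
    by (simp only: pw_inner_simps)
  then show ?thesis
    using 1 unfolding v_def by (simp add: pw_component_def)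
qed

lemma pw_component_energy_ge:
  "pw_energy m q q \<le> 2 * (\<Sum>a\<in>{0, 1}. pw_energy m (pw_component p m a q) (pw_component p m a q))"
proof -
  have "pw_deriv q = pw_deriv (pw_proj p m q) + pw_deriv (q - pw_proj p m q)"
    by (simp add: pw_deriv_linear)
  then show ?thesis
    using pw_inner_add_sq[of m "pw_deriv (pw_proj p m q)" "pw_deriv (q - pw_proj p m q)"]
    by (simp add: pw_component_def)
qed

section \<open>Transfer to the projectors on functions and on tensor products\<close>

lemma L2_proj_spline_fun:
  assumes m: "m > 0" and p: "p > 0" and q: "q \<in> spline_pieces p m"
  shows "L2_proj (splines0 p m) (spline_fun m q) = spline_fun m (pw_proj p m q)"
proof -
  \<comment> \<open>Carries the orthogonality conditions over to families, so that the definite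
    description reduces to existence and uniqueness for \<open>pw_proj\<close>.\<close>
  have inner: "L2_inner (\<lambda>t. spline_fun m q t - spline_fun m v t) (spline_fun m w) = pw_inner m (q - v) w" for v w
    using L2_inner_spline_fun[OF m, of "q - v" w] by (simp only: spline_fun_diff[abs_def])
  show ?thesis
    unfolding L2_proj_def splines0_eq[OF m p]
  proof (rule the_equality)
    show "spline_fun m (pw_proj p m q) \<in> spline_fun m ` sym_pieces 1 p m \<and>
      (\<forall>w\<in>spline_fun m ` sym_pieces 1 p m. L2_inner (\<lambda>t. spline_fun m q t - spline_fun m (pw_proj p m q) t) w = 0)"
      using pw_proj_sym pw_proj_orthogonal inner by auto
    fix u
    assume "u \<in> spline_fun m ` sym_pieces 1 p m \<and>
      (\<forall>w\<in>spline_fun m ` sym_pieces 1 p m. L2_inner (\<lambda>t. spline_fun m q t - u t) w = 0)"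
    then obtain v where v: "u = spline_fun m v" "v \<in> sym_pieces 1 p m"
      "\<And>w. w \<in> sym_pieces 1 p m \<Longrightarrow> pw_inner m (q - v) w = 0"
      using inner by auto
    show "u = spline_fun m (pw_proj p m q)"
      using v(1) pw_proj_unique[OF v(2,3)] by simp
  qed
qed

lemma spline_proj_spline_fun:
  assumes "m > 0" "p > 0" "q \<in> spline_pieces p m"
  shows "spline_proj p m a (spline_fun m q) = spline_fun m (pw_component p m a q)"
  by (simp only: spline_proj_def pw_component_def L2_proj_spline_fun[OF assms] spline_fun_diff[abs_def]
      split: if_split) simp

text \<open>Provides the linearity required by \<open>tensor_op_tensor_sum\<close>, by which the
  tensor projector may be computed from any expansion.\<close>

lemma linear_spline_proj:
  assumes m: "m > 0" and p: "p > 0"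
  shows "linear_op_on (splines p m) (spline_proj p m a)"
  unfolding linear_op_on_def
proof (intro allI impI)
  fix N c and f :: "nat \<Rightarrow> real \<Rightarrow> real"
  assume "\<forall>k<N. f k \<in> splines p m"
  then have "\<forall>k\<in>{..<N}. \<exists>q. q \<in> spline_pieces p m \<and> f k = spline_fun m q"
    unfolding splines_eq[OF m p] by blast
  from bchoice[OF this] obtain q where q: "\<And>k. k < N \<Longrightarrow> q k \<in> spline_pieces p m"
    "\<And>k. k < N \<Longrightarrow> f k = spline_fun m (q k)"
    by auto
  define Q where "Q = (\<Sum>k<N. pw_scale (c k) (q k))"
  have Q: "Q \<in> spline_pieces p m"
    unfolding Q_def using q(1)
    by (intro pieces.subspace_sum[OF subspace_spline_pieces] pieces.subspace_scale[OF subspace_spline_pieces]) auto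
  have "(\<lambda>t. \<Sum>k<N. c k * f k t) = spline_fun m Q"
    using q(2) by (auto simp: Q_def spline_fun_combination)
  then have "spline_proj p m a (\<lambda>t. \<Sum>k<N. c k * f k t) = spline_fun m (pw_component p m a Q)"
    by (simp only: spline_proj_spline_fun[OF m p Q])
  also have "\<dots> = (\<lambda>t. \<Sum>k<N. c k * spline_fun m (pw_component p m a (q k)) t)"
    by (rule ext) (simp only: Q_def pw_component_combination spline_fun_combination)
  also have "\<dots> = (\<lambda>t. \<Sum>k<N. c k * spline_proj p m a (f k) t)"
    using q by (auto simp: spline_proj_spline_fun[OF m p])
  finally show "spline_proj p m a (\<lambda>t. \<Sum>k<N. c k * f k t) = (\<lambda>t. \<Sum>k<N. c k * spline_proj p m a (f k) t)" .
qed

lemma tensor_sum_cong: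
  "(\<And>k i. k < N \<Longrightarrow> f k i = g k i) \<Longrightarrow> tensor_sum N f = tensor_sum N g"
  by (auto simp: tensor_sum_def fun_eq_iff)

lemma tensor_proj_tensor_sum:
  fixes \<alpha> :: "'n::finite \<Rightarrow> nat"
  assumes "m > 0" "p > 0" "\<And>k i. k < N \<Longrightarrow> q k i \<in> spline_pieces p m"
  shows "tensor_proj p m \<alpha> (tensor_sum N (\<lambda>k i. spline_fun m (q k i)))
    = tensor_sum N (\<lambda>k i. spline_fun m (pw_component p m (\<alpha> i) (q k i)))"
  unfolding tensor_proj_def using assms
  by (subst tensor_op_tensor_sum) (auto intro!: linear_spline_proj spline_fun_splines tensor_sum_cong simp: spline_proj_spline_fun)

lemma tensor_splinesE:
  fixes u :: "real ^ 'n::finite \<Rightarrow> real"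
  assumes "m > 0" "p > 0" "u \<in> tensor_splines p m"
  obtains N and q :: "nat \<Rightarrow> 'n \<Rightarrow> nat \<Rightarrow> real poly"
  where "\<forall>k<N. \<forall>i. q k i \<in> spline_pieces p m" "u = tensor_sum N (\<lambda>k i. spline_fun m (q k i))"
proof -
  obtain N f where f: "u = tensor_sum N f" "\<And>k i. k < N \<Longrightarrow> f k i \<in> splines p m"
    using assms(3) unfolding tensor_splines_def tensor_space_def by blast
  have "\<forall>k i. \<exists>q. k < N \<longrightarrow> q \<in> spline_pieces p m \<and> f k i = spline_fun m q"
    using f(2) unfolding splines_eq[OF assms(1,2)] by blast
  then obtain q where q: "\<And>k i. k < N \<Longrightarrow> q k i \<in> spline_pieces p m \<and> f k i = spline_fun m (q k i)"
    by metis
  show ?thesis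
    using that[of N q] q f(1) tensor_sum_cong[of N f "\<lambda>k i. spline_fun m (q k i)"] by blast
qed

section \<open>Positive semidefinite kernels and Schur products\<close>

definition psd_kernel :: "nat \<Rightarrow> (nat \<Rightarrow> nat \<Rightarrow> real) \<Rightarrow> bool" where
  "psd_kernel N G \<longleftrightarrow> (\<forall>c. 0 \<le> (\<Sum>k<N. \<Sum>l<N. c k * c l * G k l))"

lemma integral_poly_sum:
  fixes q :: "'a \<Rightarrow> real poly"
  shows "integral {a..b} (poly (\<Sum>k\<in>A. q k)) = (\<Sum>k\<in>A. integral {a..b} (poly (q k)))"
  by (induction A rule: infinite_finite_induct) (simp_all only: sum.infinite sum.empty sum.insert not_False_eq_True integral_poly_add integral_poly_0)

text \<open>The Schur product theorem for a Gram matrix \<open>\<integral> g\<^sub>k g\<^sub>l\<close>: absorb the values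
  of \<open>g\<^sub>k\<close> into the coefficients and integrate.\<close>

lemma psd_kernel_mult_inner:
  assumes "psd_kernel N G"
  shows "psd_kernel N (\<lambda>k l. G k l * pw_inner m (g k) (g l))"
  unfolding psd_kernel_def
proof
  fix c
  have "(\<Sum>k<N. \<Sum>l<N. c k * c l * (G k l * pw_inner m (g k) (g l)))
      = (\<Sum>k<N. \<Sum>l<N. \<Sum>j<m. integral {node m j..node m (Suc j)} (poly (smult (c k * c l * G k l) (g k j * g l j))))"
    by (simp add: pw_inner_def integral_poly_smult sum_distrib_left mult.assoc del: poly_smult poly_mult)
  also have "\<dots> = (\<Sum>j<m. \<Sum>k<N. \<Sum>l<N. integral {node m j..node m (Suc j)} (poly (smult (c k * c l * G k l) (g k j * g l j))))"
    by (subst sum.swap, subst sum.swap) (rule refl)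
  also have "\<dots> = (\<Sum>j<m. integral {node m j..node m (Suc j)}
      (poly (\<Sum>k<N. \<Sum>l<N. smult (c k * c l * G k l) (g k j * g l j))))"
    by (simp only: integral_poly_sum)
  also have "\<dots> \<ge> 0"
  proof (intro sum_nonneg integral_nonneg poly_integrable)
    fix j t
    have "0 \<le> (\<Sum>k<N. \<Sum>l<N. (c k * poly (g k j) t) * (c l * poly (g l j) t) * G k l)"
      using assms by (simp only: psd_kernel_def)
    then show "0 \<le> poly (\<Sum>k<N. \<Sum>l<N. smult (c k * c l * G k l) (g k j * g l j)) t"
      by (simp add: poly_sum algebra_simps)
  qed
  finally show "0 \<le> (\<Sum>k<N. \<Sum>l<N. c k * c l * (G k l * pw_inner m (g k) (g l)))" .
qed

lemma psd_kernel_mult_prod: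
  assumes "psd_kernel N G" "finite J"
  shows "psd_kernel N (\<lambda>k l. G k l * (\<Prod>j\<in>J. pw_inner m (g k j) (g l j)))"
  using assms(2)
proof (induction J rule: finite_induct)
  case (insert j J)
  from psd_kernel_mult_inner[OF insert.IH, of m "\<lambda>k. g k j"] show ?case
    using insert.hyps by (simp add: algebra_simps)
qed (use assms in simp)

lemma psd_kernel_sum_nonneg: "psd_kernel N G \<Longrightarrow> 0 \<le> (\<Sum>k<N. \<Sum>l<N. G k l)"
  unfolding psd_kernel_def by (auto dest: spec[of _ "\<lambda>_. 1"])

text \<open>Components and derivatives are linear, so the quadratic form of the kernel is the gap in
  the one-dimensional upper bound for the single spline \<open>F\<close>.\<close>

lemma psd_kernel_upper:
  assumes "m > 0" "p > 0" "\<And>k. k < N \<Longrightarrow> f k \<in> spline_pieces p m"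
  shows "psd_kernel N (\<lambda>k l. 296 * pw_energy m (f k) (f l)
    - (\<Sum>a\<in>{0, 1}. pw_energy m (pw_component p m a (f k)) (pw_component p m a (f l))))"
  unfolding psd_kernel_def
proof
  fix c
  define F where "F = (\<Sum>k<N. pw_scale (c k) (f k))"
  have F: "F \<in> spline_pieces p m"
    unfolding F_def using assms(3)
    by (intro pieces.subspace_sum[OF subspace_spline_pieces] pieces.subspace_scale[OF subspace_spline_pieces]) auto
  have "0 \<le> 296 * pw_energy m F F - (\<Sum>a\<in>{0, 1}. pw_energy m (pw_component p m a F) (pw_component p m a F))"
    using pw_component_energy_le[OF assms(1,2) F] by linarith
  also have "\<dots> = (\<Sum>k<N. \<Sum>l<N. c k * c l * (296 * pw_energy m (f k) (f l)
    - (\<Sum>a\<in>{0, 1}. pw_energy m (pw_component p m a (f k)) (pw_component p m a (f l)))))"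
    unfolding F_def pw_component_combination pw_deriv_combination pw_inner_combination
    by (simp add: sum_distrib_left sum.distrib sum_subtractf algebra_simps)
  finally show "0 \<le> (\<Sum>k<N. \<Sum>l<N. c k * c l * (296 * pw_energy m (f k) (f l)
    - (\<Sum>a\<in>{0, 1}. pw_energy m (pw_component p m a (f k)) (pw_component p m a (f l)))))" .
qed

lemma psd_kernel_lower:
  "psd_kernel N (\<lambda>k l. 2 * (\<Sum>a\<in>{0, 1}. pw_energy m (pw_component p m a (f k)) (pw_component p m a (f l)))
    - pw_energy m (f k) (f l))"
  unfolding psd_kernel_def
proof
  fix c
  define F where "F = (\<Sum>k<N. pw_scale (c k) (f k))"
  have "0 \<le> 2 * (\<Sum>a\<in>{0, 1}. pw_energy m (pw_component p m a F) (pw_component p m a F)) - pw_energy m F F"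
    using pw_component_energy_ge[of m F p] by linarith
  also have "\<dots> = (\<Sum>k<N. \<Sum>l<N. c k * c l *
      (2 * (\<Sum>a\<in>{0, 1}. pw_energy m (pw_component p m a (f k)) (pw_component p m a (f l))) - pw_energy m (f k) (f l)))"
    unfolding F_def pw_component_combination pw_deriv_combination pw_inner_combination
    by (simp add: sum_distrib_left sum.distrib sum_subtractf algebra_simps)
  finally show "0 \<le> (\<Sum>k<N. \<Sum>l<N. c k * c l *
      (2 * (\<Sum>a\<in>{0, 1}. pw_energy m (pw_component p m a (f k)) (pw_component p m a (f l))) - pw_energy m (f k) (f l)))" .
qed

section \<open>Norms of tensor product splines as Gram sums\<close>

lemma has_bochner_integral_lborel_prod:
  fixes g :: "'n::finite \<Rightarrow> real \<Rightarrow> real"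
  assumes "\<And>i. has_bochner_integral lborel (g i) (I i)"
  shows "has_bochner_integral lborel (\<lambda>x :: real ^ 'n. \<Prod>i\<in>UNIV. g i (x $ i)) (\<Prod>i\<in>UNIV. I i)"
proof -
  interpret product_sigma_finite "\<lambda>_ :: real ^ 'n. lborel :: real measure" ..
  have I: "integrable lborel (g i)" "integral\<^sup>L lborel (g i) = I i" for i
    using assms by (auto simp: has_bochner_integral_iff)
  have [measurable]: "g i \<in> borel_measurable borel" for i
    using borel_measurable_integrable[OF I(1)] by simp
  \<comment> \<open>Lebesgue measure is expressed as a product over \<open>Basis\<close>; the unit
    vectors \<open>axis i 1\<close> identify this index set with the coordinates.\<close>
  have B: "bij_betw (\<lambda>i. axis i 1) UNIV (Basis :: (real ^ 'n) set)"
    by (auto simp: bij_betw_def inj_on_def axis_eq_axis Basis_vec_def)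
  define ix where "ix = inv_into UNIV (\<lambda>i :: 'n. axis i (1 :: real))"
  have ix: "ix (axis i 1) = i" for i
    unfolding ix_def using B by (intro inv_into_f_f) (auto simp: bij_betw_def)
  have reindex: "(\<Prod>b\<in>Basis. h (ix b) b) = (\<Prod>i\<in>UNIV. h i (axis i 1))" for h :: "'n \<Rightarrow> real ^ 'n \<Rightarrow> real"
    by (subst prod.reindex_bij_betw[OF B, symmetric]) (simp add: ix)
  have comp: "(\<Sum>b\<in>Basis. y b *\<^sub>R b) $ i = y (axis i 1)" for y :: "real ^ 'n \<Rightarrow> real" and i
    by (simp add: cart_eq_inner_axis)
  let ?P = "Pi\<^sub>M (Basis :: (real ^ 'n) set) (\<lambda>_. lborel :: real measure)"
  have "has_bochner_integral ?P (\<lambda>y. \<Prod>b\<in>Basis. g (ix b) (y b)) (\<Prod>b\<in>Basis. I (ix b))"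
    unfolding has_bochner_integral_iff
    using product_integrable_prod[of Basis "\<lambda>b. g (ix b)"] product_integral_prod[of Basis "\<lambda>b. g (ix b)"] I
    by simp
  moreover have "(\<Prod>b\<in>Basis. g (ix b) (y b)) = (\<Prod>i\<in>UNIV. g i ((\<Sum>b\<in>Basis. y b *\<^sub>R b) $ i))" for y
    unfolding comp using reindex[of "\<lambda>i b. g i (y b)"] .
  moreover have "(\<Prod>b\<in>Basis. I (ix b)) = (\<Prod>i\<in>UNIV. I i)"
    using reindex[of "\<lambda>i b. I i"] .
  ultimately have "has_bochner_integral ?P (\<lambda>y. \<Prod>i\<in>UNIV. g i ((\<Sum>b\<in>Basis. y b *\<^sub>R b) $ i)) (\<Prod>i\<in>UNIV. I i)"
    by simp
  then show ?thesis
    unfolding lborel_eq[where 'a = "real ^ 'n"]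
    by (intro has_bochner_integral_distr) measurable
qed

lemma tensor_sum_square_integral:
  fixes q :: "nat \<Rightarrow> 'n::finite \<Rightarrow> nat \<Rightarrow> real poly"
  assumes "m > 0"
  shows "has_bochner_integral lborel (\<lambda>x. (tensor_sum N (\<lambda>k i. spline_fun m (q k i)) x)\<^sup>2)
    (\<Sum>k<N. \<Sum>l<N. \<Prod>i\<in>UNIV. pw_inner m (q k i) (q l i))"
proof -
  have "(tensor_sum N (\<lambda>k i. spline_fun m (q k i)) x)\<^sup>2
      = (\<Sum>k<N. \<Sum>l<N. \<Prod>i\<in>UNIV. spline_fun m (q k i) (x $ i) * spline_fun m (q l i) (x $ i))" for x
    by (simp add: tensor_sum_def power2_eq_square sum_product prod.distrib)
  then show ?thesis
    by (simp only:) (intro has_bochner_integral_sum has_bochner_integral_lborel_prod[of "\<lambda>i t. spline_fun m (q _ i) t * spline_fun m (q _ i) t"] spline_fun_inner assms)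
qed

lemma tensor_sum_outside:
  assumes "x \<notin> unit_cube"
  shows "tensor_sum N (\<lambda>k i. spline_fun m (q k i)) x = 0"
proof -
  obtain i where "x $ i \<notin> {0<..<1}"
    using assms by (auto simp: unit_cube_def)
  then have "spline_fun m (q k i) (x $ i) = 0" for k
    by (rule spline_fun_outside)
  then show ?thesis
    unfolding tensor_sum_def by (intro sum.neutral ballI prod_zero) auto
qed

lemma L2_norm_square: "(L2_norm f)\<^sup>2 = (LINT x:unit_cube|lebesgue. (norm (f x))\<^sup>2)"
  unfolding L2_norm_def by (subst real_sqrt_pow2) (auto simp: set_lebesgue_integral_def)

lemma L2_norm_tensor_sum:
  fixes q :: "nat \<Rightarrow> 'n::finite \<Rightarrow> nat \<Rightarrow> real poly"
  assumes "m > 0"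
  shows "(L2_norm (tensor_sum N (\<lambda>k i. spline_fun m (q k i))))\<^sup>2
    = (\<Sum>k<N. \<Sum>l<N. \<Prod>i\<in>UNIV. pw_inner m (q k i) (q l i))"
proof -
  let ?u = "tensor_sum N (\<lambda>k i. spline_fun m (q k i))"
  have "(L2_norm ?u)\<^sup>2 = integral\<^sup>L lebesgue (\<lambda>x. (?u x)\<^sup>2)"
    unfolding L2_norm_square set_lebesgue_integral_def
  proof (intro Bochner_Integration.integral_cong refl)
    show "indicator unit_cube x *\<^sub>R (norm (?u x))\<^sup>2 = (?u x)\<^sup>2" for x
      by (cases "x \<in> unit_cube") (simp_all add: tensor_sum_outside)
  qed
  also have "\<dots> = integral\<^sup>L lborel (\<lambda>x. (?u x)\<^sup>2)"
    using tensor_sum_square_integral[OF assms, of N q]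
    by (intro integral_completion) (auto simp: has_bochner_integral_iff)
  also have "\<dots> = (\<Sum>k<N. \<Sum>l<N. \<Prod>i\<in>UNIV. pw_inner m (q k i) (q l i))"
    using tensor_sum_square_integral[OF assms, of N q] by (simp add: has_bochner_integral_iff)
  finally show ?thesis .
qed

text \<open>Measurability of \<open>f\<close> follows from that of \<open>g\<close> by completeness
  of Lebesgue measure. This suits the classical gradient, which may be unspecified on grid
  hyperplanes.\<close>

lemma integral_lebesgue_cong_AE:
  fixes f g :: "'a::euclidean_space \<Rightarrow> real"
  assumes "AE x in lebesgue. f x = g x" "g \<in> borel_measurable lebesgue"
  shows "integral\<^sup>L lebesgue f = integral\<^sup>L lebesgue g"
proof (rule integral_cong_AE)
  show "f \<in> borel_measurable lebesgue"
  proof (rule measurableI)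
    fix A :: "real set" assume A: "A \<in> sets borel"
    show "f -` A \<inter> space lebesgue \<in> sets lebesgue"
    proof (rule completion.in_sets_AE)
      show "AE x in lebesgue. x \<in> g -` A \<inter> space lebesgue \<longleftrightarrow> x \<in> f -` A \<inter> space lebesgue"
        using assms(1) by eventually_elim simp
      show "g -` A \<inter> space lebesgue \<in> sets lebesgue"
        using measurable_sets[OF assms(2) A] .
    qed simp
  qed simp
qed (use assms in auto)

lemma AE_avoids_nodes:
  "AE x :: real ^ 'n::finite in lebesgue. \<forall>i. \<forall>j<m. x $ i \<noteq> node m j"
proof -
  have "negligible {x :: real ^ 'n. x $ i = node m j}" for i j
  proof -
    have "axis i 1 \<in> (Basis :: (real ^ 'n) set)"
      by (auto simp: Basis_vec_def)
    from negligible_standard_hyperplane[OF this, of "node m j"] show ?thesis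
      by (simp only: cart_eq_inner_axis[symmetric])
  qed
  then have "AE x :: real ^ 'n in lebesgue. x $ i \<noteq> node m j" for i j
    using AE_not_in[of "{x :: real ^ 'n. x $ i = node m j}" lebesgue] by (simp add: negligible_iff_null_sets)
  then have "AE x :: real ^ 'n in lebesgue. \<forall>i\<in>UNIV. \<forall>j\<in>{..<m}. x $ i \<noteq> node m j"
    by (intro AE_finite_allI finite) auto
  then show ?thesis
    by (rule eventually_mono) auto
qed

lemma spline_fun_deriv_piece:
  assumes "j < m" "t \<in> {node m j<..<node m (Suc j)}"
  shows "(spline_fun m q has_real_derivative spline_fun m (pw_deriv q) t) (at t)"
proof -
  have "(poly (q j) has_real_derivative spline_fun m (pw_deriv q) t) (at t)"
    using spline_fun_open_piece[OF assms, of "pw_deriv q"] poly_DERIV[of "q j" t] by (simp add: pw_deriv_def)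
  then show ?thesis
    by (rule has_field_derivative_transform_within_open[OF _ open_greaterThanLessThan assms(2)])
      (simp add: spline_fun_open_piece[OF assms(1)])
qed

definition partial_pieces :: "'n \<Rightarrow> (nat \<Rightarrow> 'n \<Rightarrow> nat \<Rightarrow> real poly) \<Rightarrow> nat \<Rightarrow> 'n \<Rightarrow> nat \<Rightarrow> real poly" where
  "partial_pieces i q k j = (if j = i then pw_deriv (q k j) else q k j)"

text \<open>Along a coordinate line a tensor spline is a combination of one-dimensional splines with
  fixed coefficients \<open>R\<close>; off the nodes these are differentiated piece by
  piece.\<close>

lemma gradient_tensor_sum:
  fixes q :: "nat \<Rightarrow> 'n::finite \<Rightarrow> nat \<Rightarrow> real poly"
  assumes m: "m > 0" and x: "x \<in> unit_cube" "\<forall>i. \<forall>j<m. x $ i \<noteq> node m j"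
  shows "gradient (tensor_sum N (\<lambda>k i. spline_fun m (q k i))) x $ i
    = tensor_sum N (\<lambda>k j. spline_fun m (partial_pieces i q k j)) x"
proof -
  have xi: "x $ i \<in> {0<..<1}"
    using x(1) by (simp add: unit_cube_def)
  obtain j where j: "j < m" "node m j \<le> x $ i" "x $ i < node m (Suc j)"
    using node_cases[OF m xi] .
  then have xj: "x $ i \<in> {node m j<..<node m (Suc j)}"
    using x(2)[rule_format, OF j(1), of i] by simp
  define R where "R k = (\<Prod>j\<in>UNIV - {i}. spline_fun m (q k j) (x $ j))" for k
  have line: "tensor_sum N (\<lambda>k i. spline_fun m (q k i)) (x + t *\<^sub>R axis i 1)
      = (\<Sum>k<N. spline_fun m (q k i) (x $ i + t) * R k)" for t
    unfolding tensor_sum_def R_def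
    by (subst prod.remove[of UNIV i]) (auto intro!: sum.cong prod.cong simp: axis_def)
  have "((\<lambda>t. \<Sum>k<N. spline_fun m (q k i) (x $ i + t) * R k)
      has_real_derivative (\<Sum>k<N. spline_fun m (pw_deriv (q k i)) (x $ i) * R k)) (at 0)"
  proof (intro DERIV_sum DERIV_cmult_right)
    fix k
    have "((\<lambda>t. spline_fun m (q k i) (t + x $ i)) has_real_derivative spline_fun m (pw_deriv (q k i)) (x $ i)) (at 0)"
      using spline_fun_deriv_piece[OF j(1) xj, of "q k i"] DERIV_shift[of "spline_fun m (q k i)" _ 0 "x $ i"] by simp
    then show "((\<lambda>t. spline_fun m (q k i) (x $ i + t)) has_real_derivative spline_fun m (pw_deriv (q k i)) (x $ i)) (at 0)"
      by (simp add: add.commute)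
  qed
  then have "gradient (tensor_sum N (\<lambda>k i. spline_fun m (q k i))) x $ i
      = (\<Sum>k<N. spline_fun m (pw_deriv (q k i)) (x $ i) * R k)"
    by (simp only: gradient_def vec_lambda_beta line DERIV_imp_deriv)
  also have "\<dots> = tensor_sum N (\<lambda>k j. spline_fun m (partial_pieces i q k j)) x"
    unfolding tensor_sum_def R_def partial_pieces_def
    by (subst prod.remove[of UNIV i]) (auto intro!: sum.cong prod.cong)
  finally show ?thesis .
qed

text \<open>Almost everywhere each partial derivative is again a tensor sum, so its squared norm is
  a Gram sum.\<close>

lemma H1_seminorm_tensor_sum:
  fixes q :: "nat \<Rightarrow> 'n::finite \<Rightarrow> nat \<Rightarrow> real poly"
  assumes "m > 0"
  shows "(H1_seminorm (tensor_sum N (\<lambda>k i. spline_fun m (q k i))))\<^sup>2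
    = (\<Sum>i\<in>UNIV. \<Sum>k<N. \<Sum>l<N. pw_energy m (q k i) (q l i) * (\<Prod>j\<in>UNIV - {i}. pw_inner m (q k j) (q l j)))"
proof -
  let ?u = "tensor_sum N (\<lambda>k i. spline_fun m (q k i))"
  let ?d = "\<lambda>i. tensor_sum N (\<lambda>k j. spline_fun m (partial_pieces i q k j))"
  have int: "has_bochner_integral lborel (\<lambda>x. \<Sum>i\<in>UNIV. (?d i x)\<^sup>2)
      (\<Sum>i\<in>UNIV. \<Sum>k<N. \<Sum>l<N. \<Prod>j\<in>UNIV. pw_inner m (partial_pieces i q k j) (partial_pieces i q l j))"
    by (intro has_bochner_integral_sum tensor_sum_square_integral assms)
  then have meas: "(\<lambda>x. \<Sum>i\<in>UNIV. (?d i x)\<^sup>2) \<in> borel_measurable lborel"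
    by (auto simp: has_bochner_integral_iff)
  have "(H1_seminorm ?u)\<^sup>2 = integral\<^sup>L lebesgue (\<lambda>x. indicator unit_cube x *\<^sub>R (norm (gradient ?u x))\<^sup>2)"
    unfolding H1_seminorm_def L2_norm_square set_lebesgue_integral_def ..
  also have "\<dots> = integral\<^sup>L lebesgue (\<lambda>x. \<Sum>i\<in>UNIV. (?d i x)\<^sup>2)"
  proof (rule integral_lebesgue_cong_AE)
    show "(\<lambda>x. \<Sum>i\<in>UNIV. (?d i x)\<^sup>2) \<in> borel_measurable lebesgue"
      using meas by (rule measurable_completion)
    show "AE x in lebesgue. indicator unit_cube x *\<^sub>R (norm (gradient ?u x))\<^sup>2 = (\<Sum>i\<in>UNIV. (?d i x)\<^sup>2)"
      using AE_avoids_nodes[of m]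
    proof eventually_elim
      case (elim x)
      show ?case
      proof (cases "x \<in> unit_cube")
        case True
        have "(norm (gradient ?u x))\<^sup>2 = (\<Sum>i\<in>UNIV. (gradient ?u x $ i)\<^sup>2)"
          unfolding power2_norm_eq_inner inner_vec_def by (simp add: power2_eq_square)
        then show ?thesis
          using True by (simp add: gradient_tensor_sum[OF assms True elim])
      qed (simp add: tensor_sum_outside)
    qed
  qed
  also have "\<dots> = (\<Sum>i\<in>UNIV. \<Sum>k<N. \<Sum>l<N. \<Prod>j\<in>UNIV. pw_inner m (partial_pieces i q k j) (partial_pieces i q l j))"
    using int meas by (subst integral_completion) (auto simp: has_bochner_integral_iff)
  also have "\<dots> = (\<Sum>i\<in>UNIV. \<Sum>k<N. \<Sum>l<N. pw_energy m (q k i) (q l i) * (\<Prod>j\<in>UNIV - {i}. pw_inner m (q k j) (q l j)))"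
  proof (intro sum.cong refl)
    show "(\<Prod>j\<in>UNIV. pw_inner m (partial_pieces i q k j) (partial_pieces i q l j))
      = pw_energy m (q k i) (q l i) * (\<Prod>j\<in>UNIV - {i}. pw_inner m (q k j) (q l j))" for i k l
      unfolding partial_pieces_def by (subst prod.remove[of UNIV i]) (auto intro!: prod.cong)
  qed
  finally show ?thesis .
qed

section \<open>Summation over all components\<close>

lemma sum_components_split:
  fixes F G :: "nat \<Rightarrow> 'n::finite \<Rightarrow> real"
  shows "(\<Sum>\<alpha>\<in>UNIV \<rightarrow>\<^sub>E {0, 1}. F (\<alpha> i) i * (\<Prod>j\<in>UNIV - {i}. G (\<alpha> j) j))
    = (\<Sum>a\<in>{0, 1}. F a i) * (\<Prod>j\<in>UNIV - {i}. \<Sum>a\<in>{0, 1}. G a j)"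
proof -
  \<comment> \<open>One factor per coordinate, so that the distributive law turns the sum over
    choice functions into a product of sums.\<close>
  define H where "H j a = (if j = i then F a j else G a j)" for j a
  have "(\<Sum>a\<in>{0, 1}. F a i) * (\<Prod>j\<in>UNIV - {i}. \<Sum>a\<in>{0, 1}. G a j) = (\<Prod>j\<in>UNIV. \<Sum>a\<in>{0, 1}. H j a)"
    by (subst prod.remove[of UNIV i]) (auto intro!: prod.cong simp: H_def)
  also have "\<dots> = (\<Sum>\<alpha>\<in>UNIV \<rightarrow>\<^sub>E {0, 1}. \<Prod>j\<in>UNIV. H j (\<alpha> j))"
    by (intro prod_sum_PiE) auto
  also have "\<dots> = (\<Sum>\<alpha>\<in>UNIV \<rightarrow>\<^sub>E {0, 1}. F (\<alpha> i) i * (\<Prod>j\<in>UNIV - {i}. G (\<alpha> j) j))"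
  proof (intro sum.cong refl)
    show "(\<Prod>j\<in>UNIV. H j (\<alpha> j)) = F (\<alpha> i) i * (\<Prod>j\<in>UNIV - {i}. G (\<alpha> j) j)" for \<alpha>
      by (subst prod.remove[of UNIV i]) (auto intro!: prod.cong simp: H_def)
  qed
  finally show ?thesis ..
qed

text \<open>Only direction \<open>i\<close> keeps component energies; in every other direction the
  sum over both components restores the L2 form by \<open>pw_component_inner_sum\<close>.\<close>

lemma sum_H1_seminorm_components:
  fixes q :: "nat \<Rightarrow> 'n::finite \<Rightarrow> nat \<Rightarrow> real poly"
  assumes "m > 0"
  shows "(\<Sum>\<alpha>\<in>UNIV \<rightarrow>\<^sub>E {0, 1}. (H1_seminorm (tensor_sum N (\<lambda>k i. spline_fun m (pw_component p m (\<alpha> i) (q k i)))))\<^sup>2)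
    = (\<Sum>i\<in>UNIV. \<Sum>k<N. \<Sum>l<N.
        (\<Sum>a\<in>{0, 1}. pw_energy m (pw_component p m a (q k i)) (pw_component p m a (q l i)))
        * (\<Prod>j\<in>UNIV - {i}. pw_inner m (q k j) (q l j)))"
    (is "(\<Sum>\<alpha>\<in>?A. _) = _")
proof -
  let ?C = "\<lambda>a k i. pw_component p m a (q k i)"
  have "(\<Sum>\<alpha>\<in>?A. (H1_seminorm (tensor_sum N (\<lambda>k i. spline_fun m (?C (\<alpha> i) k i))))\<^sup>2)
      = (\<Sum>\<alpha>\<in>?A. \<Sum>i\<in>UNIV. \<Sum>k<N. \<Sum>l<N. pw_energy m (?C (\<alpha> i) k i) (?C (\<alpha> i) l i)
          * (\<Prod>j\<in>UNIV - {i}. pw_inner m (?C (\<alpha> j) k j) (?C (\<alpha> j) l j)))"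
    by (simp only: H1_seminorm_tensor_sum[OF assms])
  also have "\<dots> = (\<Sum>i\<in>UNIV. \<Sum>\<alpha>\<in>?A. \<Sum>k<N. \<Sum>l<N. pw_energy m (?C (\<alpha> i) k i) (?C (\<alpha> i) l i)
          * (\<Prod>j\<in>UNIV - {i}. pw_inner m (?C (\<alpha> j) k j) (?C (\<alpha> j) l j)))"
    by (rule sum.swap)
  also have "\<dots> = (\<Sum>i\<in>UNIV. \<Sum>k<N. \<Sum>\<alpha>\<in>?A. \<Sum>l<N. pw_energy m (?C (\<alpha> i) k i) (?C (\<alpha> i) l i)
          * (\<Prod>j\<in>UNIV - {i}. pw_inner m (?C (\<alpha> j) k j) (?C (\<alpha> j) l j)))"
    by (intro sum.cong refl) (rule sum.swap)
  also have "\<dots> = (\<Sum>i\<in>UNIV. \<Sum>k<N. \<Sum>l<N. \<Sum>\<alpha>\<in>?A. pw_energy m (?C (\<alpha> i) k i) (?C (\<alpha> i) l i)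
          * (\<Prod>j\<in>UNIV - {i}. pw_inner m (?C (\<alpha> j) k j) (?C (\<alpha> j) l j)))"
    by (intro sum.cong refl) (rule sum.swap)
  also have "\<dots> = (\<Sum>i\<in>UNIV. \<Sum>k<N. \<Sum>l<N. (\<Sum>a\<in>{0, 1}. pw_energy m (?C a k i) (?C a l i))
        * (\<Prod>j\<in>UNIV - {i}. \<Sum>a\<in>{0, 1}. pw_inner m (?C a k j) (?C a l j)))"
  proof (intro sum.cong refl)
    fix i k l
    show "(\<Sum>\<alpha>\<in>?A. pw_energy m (?C (\<alpha> i) k i) (?C (\<alpha> i) l i)
          * (\<Prod>j\<in>UNIV - {i}. pw_inner m (?C (\<alpha> j) k j) (?C (\<alpha> j) l j)))
      = (\<Sum>a\<in>{0, 1}. pw_energy m (?C a k i) (?C a l i))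
        * (\<Prod>j\<in>UNIV - {i}. \<Sum>a\<in>{0, 1}. pw_inner m (?C a k j) (?C a l j))"
      using sum_components_split[of "\<lambda>a i. pw_energy m (?C a k i) (?C a l i)" i
          "\<lambda>a j. pw_inner m (?C a k j) (?C a l j)"] .
  qed
  finally show ?thesis
    by (simp only: pw_component_inner_sum)
qed

text \<open>Here every factor is an L2 form, so the summed norms reproduce the original one
  exactly.\<close>

lemma sum_L2_norm_components:
  fixes q :: "nat \<Rightarrow> 'n::finite \<Rightarrow> nat \<Rightarrow> real poly"
  assumes "m > 0"
  shows "(\<Sum>\<alpha>\<in>UNIV \<rightarrow>\<^sub>E {0, 1}. (L2_norm (tensor_sum N (\<lambda>k i. spline_fun m (pw_component p m (\<alpha> i) (q k i)))))\<^sup>2)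
    = (L2_norm (tensor_sum N (\<lambda>k i. spline_fun m (q k i))))\<^sup>2"
    (is "(\<Sum>\<alpha>\<in>?A. _) = _")
proof -
  let ?C = "\<lambda>a k i. pw_component p m a (q k i)"
  have "(\<Sum>\<alpha>\<in>?A. (L2_norm (tensor_sum N (\<lambda>k i. spline_fun m (?C (\<alpha> i) k i))))\<^sup>2)
      = (\<Sum>\<alpha>\<in>?A. \<Sum>k<N. \<Sum>l<N. \<Prod>j\<in>UNIV. pw_inner m (?C (\<alpha> j) k j) (?C (\<alpha> j) l j))"
    by (simp only: L2_norm_tensor_sum[OF assms])
  also have "\<dots> = (\<Sum>k<N. \<Sum>\<alpha>\<in>?A. \<Sum>l<N. \<Prod>j\<in>UNIV. pw_inner m (?C (\<alpha> j) k j) (?C (\<alpha> j) l j))"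
    by (rule sum.swap)
  also have "\<dots> = (\<Sum>k<N. \<Sum>l<N. \<Sum>\<alpha>\<in>?A. \<Prod>j\<in>UNIV. pw_inner m (?C (\<alpha> j) k j) (?C (\<alpha> j) l j))"
    by (intro sum.cong refl) (rule sum.swap)
  also have "\<dots> = (\<Sum>k<N. \<Sum>l<N. \<Prod>j\<in>UNIV. \<Sum>a\<in>{0, 1}. pw_inner m (?C a k j) (?C a l j))"
    by (intro sum.cong refl prod_sum_PiE[symmetric]) auto
  finally show ?thesis
    by (simp only: pw_component_inner_sum L2_norm_tensor_sum[OF assms])
qed

lemma H1_norm_square: "(H1_norm u)\<^sup>2 = (L2_norm u)\<^sup>2 + (H1_seminorm u)\<^sup>2"
  by (simp add: H1_norm_def)

section \<open>Two-sided bounds for the seminorm and the full norm\<close>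

theorem theorem6:
  "\<exists>c>0. \<forall>p\<ge>1. \<forall>m\<ge>1. \<forall>u \<in> (tensor_splines p m :: (real ^ 'n::finite \<Rightarrow> real) set).
     (H1_seminorm u)\<^sup>2 / c
       \<le> (\<Sum>\<alpha>\<in>(UNIV :: 'n set) \<rightarrow>\<^sub>E {0, 1}. (H1_seminorm (tensor_proj p m \<alpha> u))\<^sup>2) \<and>
     (\<Sum>\<alpha>\<in>(UNIV :: 'n set) \<rightarrow>\<^sub>E {0, 1}. (H1_seminorm (tensor_proj p m \<alpha> u))\<^sup>2)
       \<le> c * (H1_seminorm u)\<^sup>2 \<and>
     (H1_norm u)\<^sup>2 / c
       \<le> (\<Sum>\<alpha>\<in>(UNIV :: 'n set) \<rightarrow>\<^sub>E {0, 1}. (H1_norm (tensor_proj p m \<alpha> u))\<^sup>2) \<and>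
     (\<Sum>\<alpha>\<in>(UNIV :: 'n set) \<rightarrow>\<^sub>E {0, 1}. (H1_norm (tensor_proj p m \<alpha> u))\<^sup>2)
       \<le> c * (H1_norm u)\<^sup>2"
proof (intro exI[of _ 296] conjI allI impI ballI)
  \<comment> \<open>The one-dimensional constant 296 serves both directions and every dimension,
    since multiplication with Gram kernels does not enlarge it.\<close>
  fix p m :: nat and u :: "real ^ 'n \<Rightarrow> real"
  assume "p \<ge> 1" "m \<ge> 1" and u: "u \<in> tensor_splines p m"
  then have p: "p > 0" and m: "m > 0" by auto
  obtain N and q :: "nat \<Rightarrow> 'n \<Rightarrow> nat \<Rightarrow> real poly"
    where q': "\<forall>k<N. \<forall>i. q k i \<in> spline_pieces p m" and u_eq: "u = tensor_sum N (\<lambda>k i. spline_fun m (q k i))"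
    using tensor_splinesE[OF m p u] .
  then have q: "\<And>k i. k < N \<Longrightarrow> q k i \<in> spline_pieces p m"
    by blast
  let ?A = "(UNIV :: 'n set) \<rightarrow>\<^sub>E {0 :: nat, 1}"
  define S where "S = (\<Sum>\<alpha>\<in>?A. (H1_seminorm (tensor_proj p m \<alpha> u))\<^sup>2)"
  define s where "s = (H1_seminorm u)\<^sup>2"
  define l where "l = (L2_norm u)\<^sup>2"
  have proj: "tensor_proj p m \<alpha> u = tensor_sum N (\<lambda>k i. spline_fun m (pw_component p m (\<alpha> i) (q k i)))" for \<alpha>
    unfolding u_eq using tensor_proj_tensor_sum[where q = q, OF m p q] .
  let ?E = "\<lambda>k l i. pw_energy m (q k i) (q l i)"
  let ?F = "\<lambda>k l i. \<Sum>a\<in>{0, 1}. pw_energy m (pw_component p m a (q k i)) (pw_component p m a (q l i))"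
  let ?P = "\<lambda>k l i. \<Prod>j\<in>UNIV - {i}. pw_inner m (q k j) (q l j)"
  have lin: "(\<Sum>i\<in>UNIV. \<Sum>k<N. \<Sum>l<N. (c * f k l i - g k l i) * h k l i)
      = c * (\<Sum>i\<in>UNIV. \<Sum>k<N. \<Sum>l<N. f k l i * h k l i) - (\<Sum>i\<in>UNIV. \<Sum>k<N. \<Sum>l<N. g k l i * h k l i)"
    for c and f g h :: "nat \<Rightarrow> nat \<Rightarrow> 'n \<Rightarrow> real"
    by (simp only: left_diff_distrib sum_subtractf sum_distrib_left mult.assoc)
  have s: "s = (\<Sum>i\<in>UNIV. \<Sum>k<N. \<Sum>l<N. ?E k l i * ?P k l i)"
    unfolding s_def u_eq by (rule H1_seminorm_tensor_sum[OF m])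
  have S: "S = (\<Sum>i\<in>UNIV. \<Sum>k<N. \<Sum>l<N. ?F k l i * ?P k l i)"
    unfolding S_def proj by (rule sum_H1_seminorm_components[OF m])
  \<comment> \<open>The kernel of the one-dimensional bound is multiplied by the Gram kernels of the
    other directions; all coefficients equal to 1 give the sum.\<close>
  have "0 \<le> (\<Sum>k<N. \<Sum>l<N. (296 * ?E k l i - ?F k l i) * ?P k l i)" for i
    by (intro psd_kernel_sum_nonneg psd_kernel_mult_prod psd_kernel_upper m p q) auto
  then have "0 \<le> (\<Sum>i\<in>UNIV. \<Sum>k<N. \<Sum>l<N. (296 * ?E k l i - ?F k l i) * ?P k l i)"
    by (rule sum_nonneg)
  also have "\<dots> = 296 * s - S"
    unfolding s S by (rule lin)
  finally have upper: "S \<le> 296 * s"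
    by simp
  have "0 \<le> (\<Sum>k<N. \<Sum>l<N. (2 * ?F k l i - ?E k l i) * ?P k l i)" for i
    by (intro psd_kernel_sum_nonneg psd_kernel_mult_prod psd_kernel_lower) auto
  then have "0 \<le> (\<Sum>i\<in>UNIV. \<Sum>k<N. \<Sum>l<N. (2 * ?F k l i - ?E k l i) * ?P k l i)"
    by (rule sum_nonneg)
  also have "\<dots> = 2 * S - s"
    unfolding s S by (rule lin)
  finally have lower: "s \<le> 2 * S"
    by simp
  have nonneg: "0 \<le> S" "0 \<le> s" "0 \<le> l"
    by (auto simp: S_def s_def l_def intro: sum_nonneg)
  have "(\<Sum>\<alpha>\<in>?A. (L2_norm (tensor_proj p m \<alpha> u))\<^sup>2) = l"
    by (simp only: proj l_def) (simp only: u_eq sum_L2_norm_components[OF m])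
  \<comment> \<open>The L2 parts agree exactly, so the bounds for the full norm follow from those
    for the seminorm.\<close>
  then have H1: "(\<Sum>\<alpha>\<in>?A. (H1_norm (tensor_proj p m \<alpha> u))\<^sup>2) = l + S"
    by (simp add: H1_norm_square sum.distrib S_def)
  show "(H1_seminorm u)\<^sup>2 / 296 \<le> (\<Sum>\<alpha>\<in>?A. (H1_seminorm (tensor_proj p m \<alpha> u))\<^sup>2)"
    "(\<Sum>\<alpha>\<in>?A. (H1_seminorm (tensor_proj p m \<alpha> u))\<^sup>2) \<le> 296 * (H1_seminorm u)\<^sup>2"
    unfolding S_def[symmetric] s_def[symmetric] using upper lower nonneg by auto
  show "(H1_norm u)\<^sup>2 / 296 \<le> (\<Sum>\<alpha>\<in>?A. (H1_norm (tensor_proj p m \<alpha> u))\<^sup>2)"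
    "(\<Sum>\<alpha>\<in>?A. (H1_norm (tensor_proj p m \<alpha> u))\<^sup>2) \<le> 296 * (H1_norm u)\<^sup>2"
    unfolding H1 unfolding H1_norm_square s_def[symmetric] l_def[symmetric] using upper lower nonneg by auto
qed simp

end
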